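(* Let $r$ and $\ell$ be integers with $r\ge 3$ and $\ell\ge 4$. Then there exists $n_0=n_0(r,\ell)$ such that the following holds for every $n\ge n_0$. Let $\dot G=(G,\sigma)$ be a $\dot{\mathcal C}_{\ge \ell}^{-}$-free unbalanced signed graph on $n$ vertices with clique number at most $r$. If $\dot G$ is extremal, i.e. has the maximum number of edges among all $\dot{\mathcal C}_{\ge \ell}^{-}$-free unbalanced signed graphs on $n$ vertices with clique number at most $r$, then $\dot G$ is switching isomorphic to $C_3^{-}\cdot T_r(n-2)$.
   Context: All graphs are finite and simple. The Turán graph $T_r(m)$ is the complete balanced $r$-partite graph on $m$ vertices. A signed graph is a pair $\dot G=(G,\sigma)$, where $G$ is a graph (the underlying graph) and $\sigma:E(G)\to\{+1,-1\}$; its number of edges and its clique number are those of $G$. $(G,+)$ denotes the signed graph on $G$ with all edges positive. The sign of a cycle is the product of the signs of its edges; a cycle is negative if its sign is $-1$. $C_3^-$ denotes a negative triangle. $\dot{\mathcal C}_{\ge \ell}^{-}$ is the set of negative cycles of length at least $\ell$; a signed graph is $\dot{\mathcal C}_{\ge \ell}^{-}$-free if it contains no negative cycle of length at least $\ell$. For $U\subseteq V(G)$, switching at $U$ reverses the sign of every edge between $U$ and $V(G)\setminus U$; two signed graphs are switching equivalent if one is obtained from the other by a switching. A signed graph is balanced if it is switching equivalent to an all-positive signed graph (equivalently, it contains no negative cycle), and unbalanced otherwise. Two signed graphs are switching isomorphic if one is isomorphic to a signed graph obtained from the other by a switching. $C_3^-\cdot T_r(n-2)$ denotes a signed graph on $n$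 vertices obtained by identifying a vertex of $C_3^-$ with a vertex of $(T_r(n-2),+)$ (any choice of the vertex of $T_r(n-2)$ is allowed). *)

theory Defs
  imports "HOL-Library.Ramsey"
begin

section \<open>Finite simple graphs\<close>

text \<open>Edges are two-element sets of vertices.\<close>

record 'a graph =
  verts :: "'a set"
  edges :: "'a set set"

definition simple_graph :: "('a, 'b) graph_scheme \<Rightarrow> bool" where
  "simple_graph G \<longleftrightarrow> finite (verts G) \<and> edges G \<subseteq> nsets (verts G) 2"

definition clique_number :: "('a, 'b) graph_scheme \<Rightarrow> nat" where
  "clique_number G = Max (card ` {K. K \<subseteq> verts G \<and> clique K (edges G)})"

definition cycle_edges :: "'a list \<Rightarrow> 'a set set" where
  "cycle_edges xs = {{xs ! i, xs ! (Suc i mod length xs)} | i. i < length xs}"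

definition is_cycle :: "('a, 'b) graph_scheme \<Rightarrow> 'a list \<Rightarrow> bool" where
  "is_cycle G xs \<longleftrightarrow>
     3 \<le> length xs \<and> distinct xs \<and> set xs \<subseteq> verts G \<and> cycle_edges xs \<subseteq> edges G"

text \<open>
  The graph T is a Turan graph if it is complete multipartite with respect to the parts
  {v. part v = i} for i < r, and the sizes of any two parts differ by at most one.  Parts may be
  empty, which happens exactly if m < r.
\<close>

definition turan_graph :: "nat \<Rightarrow> nat \<Rightarrow> 'a graph \<Rightarrow> bool" where
  "turan_graph r m T \<longleftrightarrow> simple_graph T \<and> card (verts T) = m \<and>
     (\<exists>part :: 'a \<Rightarrow> nat.
        (\<forall>v \<in> verts T. part v < r) \<and>
        edges T = {{u, v} | u v. u \<in> verts T \<and> v \<in> verts T \<and> part u \<noteq> part v} \<and>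
        (\<forall>i < r. \<forall>j < r. card {v \<in> verts T. part v = i} \<le> card {v \<in> verts T. part v = j} + 1))"


section \<open>Signed graphs\<close>

text \<open>
  Only the values of the sign function on the edges are meaningful; all notions below ignore its
  values elsewhere.
\<close>

record 'a signed_graph = "'a graph" +
  sign :: "'a set \<Rightarrow> int"

definition signed_graph :: "'a signed_graph \<Rightarrow> bool" where
  "signed_graph G \<longleftrightarrow> simple_graph G \<and> (\<forall>e \<in> edges G. sign G e \<in> {1, - 1})"

definition all_positive :: "'a signed_graph \<Rightarrow> bool" where
  "all_positive G \<longleftrightarrow> (\<forall>e \<in> edges G. sign G e = 1)"

definition positive_signed :: "'a graph \<Rightarrow> 'a signed_graph" where
  "positive_signed G = \<lparr>verts = verts G, edges = edges G, sign = (\<lambda>_. 1)\<rparr>"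

definition cycle_sign :: "'a signed_graph \<Rightarrow> 'a list \<Rightarrow> int" where
  "cycle_sign G xs = (\<Prod>e \<in> cycle_edges xs. sign G e)"

definition negative_cycle :: "'a signed_graph \<Rightarrow> 'a list \<Rightarrow> bool" where
  "negative_cycle G xs \<longleftrightarrow> is_cycle G xs \<and> cycle_sign G xs = - 1"

definition long_negative_cycle_free :: "nat \<Rightarrow> 'a signed_graph \<Rightarrow> bool" where
  "long_negative_cycle_free l G \<longleftrightarrow> \<not> (\<exists>xs. negative_cycle G xs \<and> l \<le> length xs)"

definition switching :: "'a set \<Rightarrow> 'a signed_graph \<Rightarrow> 'a signed_graph" where
  "switching U G =
     G\<lparr>sign := (\<lambda>e. if e \<inter> U \<noteq> {} \<and> e - U \<noteq> {} then - sign G e else sign G e)\<rparr>"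

definition switching_equivalent :: "'a signed_graph \<Rightarrow> 'a signed_graph \<Rightarrow> bool" where
  "switching_equivalent G H \<longleftrightarrow> verts H = verts G \<and> edges H = edges G \<and>
     (\<exists>U \<subseteq> verts G. \<forall>e \<in> edges G. sign H e = sign (switching U G) e)"

definition balanced :: "'a signed_graph \<Rightarrow> bool" where
  "balanced G \<longleftrightarrow> (\<exists>H. signed_graph H \<and> all_positive H \<and> switching_equivalent G H)"

definition isomorphic :: "'a signed_graph \<Rightarrow> 'b signed_graph \<Rightarrow> bool" where
  "isomorphic G H \<longleftrightarrow>
     (\<exists>f. bij_betw f (verts G) (verts H) \<and> edges H = (\<lambda>e. f ` e) ` edges G \<and>
          (\<forall>e \<in> edges G. sign H (f ` e) = sign G e))"

definition switching_isomorphic :: "'a signed_graph \<Rightarrow> 'b signed_graph \<Rightarrow> bool" where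
  "switching_isomorphic G H \<longleftrightarrow> (\<exists>K. switching_equivalent H K \<and> isomorphic G K)"


section \<open>The graphs of the extremal problem\<close>

definition negative_triangle :: "'a signed_graph \<Rightarrow> bool" where
  "negative_triangle C \<longleftrightarrow> signed_graph C \<and>
     (\<exists>xs. length xs = 3 \<and> verts C = set xs \<and> edges C = cycle_edges xs \<and> negative_cycle C xs)"

definition signed_union :: "'a signed_graph \<Rightarrow> 'a signed_graph \<Rightarrow> 'a signed_graph" where
  "signed_union G H =
     \<lparr>verts = verts G \<union> verts H, edges = edges G \<union> edges H,
      sign = (\<lambda>e. if e \<in> edges G then sign G e else sign H e)\<rparr>"

text \<open>
  Identifying a vertex of one graph with a vertex of another one amounts to forming the union of
  copies that have exactly one vertex in common.  The common vertex v is arbitrary, and so is the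
  assignment of signs to the edges of the triangle as long as their product is negative.
\<close>

definition negative_triangle_dot_turan :: "nat \<Rightarrow> nat \<Rightarrow> 'a signed_graph \<Rightarrow> bool" where
  "negative_triangle_dot_turan r m H \<longleftrightarrow>
     (\<exists>C T v. negative_triangle C \<and> turan_graph r m T \<and> verts C \<inter> verts T = {v} \<and>
        H = signed_union C (positive_signed T))"

definition admissible :: "nat \<Rightarrow> nat \<Rightarrow> nat \<Rightarrow> 'a signed_graph \<Rightarrow> bool" where
  "admissible r l n G \<longleftrightarrow> signed_graph G \<and> card (verts G) = n \<and>
     long_negative_cycle_free l G \<and> \<not> balanced G \<and> clique_number G \<le> r"

text \<open>
  The competitors have their vertices in the same type as G.  This is no restriction: as the type
  contains the n vertices of G, it contains a copy of every signed graph on n vertices.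
\<close>

definition extremal :: "nat \<Rightarrow> nat \<Rightarrow> nat \<Rightarrow> 'a signed_graph \<Rightarrow> bool" where
  "extremal r l n G \<longleftrightarrow> admissible r l n G \<and>
     (\<forall>H :: 'a signed_graph. admissible r l n H \<longrightarrow> card (edges H) \<le> card (edges G))"

end

theory Submission
  imports Defs
begin

text \<open>
  The key observation is that long ears turn a short negative cycle into a long one: a path between
  two vertices of a negative cycle closes a negative cycle with one of the two arcs
  (\<open>theta_negative_cycle\<close>).  So if negative cycles have fewer than \<open>l\<close> vertices, no negative cycle has
  two vertices in a set whose vertices are pairwise joined by very long paths
  (\<open>negative_cycle_meets_linked_set\<close>).

  An extremal graph is very dense: gluing a negative triangle to a Turan graph shows that it has at
  least \<open>t(n - 2) + 3\<close> edges, where \<open>t(m)\<close> is the number of edges of the Turan graph on \<open>m\<close> vertices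
  (\<open>exists_admissible\<close>).  Since \<open>t(m)\<close> is about \<open>(1 - 1/r) m\<^sup>2 / 2 \<ge> m\<^sup>2 / 3\<close>, all but at most \<open>50\<close>
  vertices lie in a core in which every vertex is adjacent to well over half of the others
  (\<open>exists_dense_core\<close>), and such a core is linked by long paths (\<open>linked_of_min_degree\<close>).
  A maximal linked set \<open>B\<close> above the core receives at most one edge from each outside vertex.  By
  Turan's theorem, \<open>B\<close> must then miss at most two vertices.  A negative cycle exists
  (\<open>exists_negative_cycle\<close>, Harary's theorem) and has at most one vertex in \<open>B\<close>; hence exactly two vertices
  \<open>x\<close>, \<open>y\<close> are outside, and the cycle is a triangle \<open>x y z\<close> hanging on \<open>B\<close> at \<open>z\<close>.  The edges inside \<open>B\<close>
  number at least \<open>t(n - 2)\<close>, so they form a Turan graph by the uniqueness part of Turan's theorem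
  (\<open>turan_unique\<close>), and they contain no negative cycle, so a switching makes them positive.

  The lemmas speak of vertex sets and edge sets instead of graph records, and of lists of
  vertices for walks; the sign of a walk is multiplicative under concatenation.
\<close>

section \<open>Counting edges\<close>

definition nbrs_in :: "'a set set \<Rightarrow> 'a set \<Rightarrow> 'a \<Rightarrow> 'a set" where
  "nbrs_in E S v = {u \<in> S. {v, u} \<in> E}"

definition induced :: "'a set set \<Rightarrow> 'a set \<Rightarrow> 'a set set" where
  "induced E S = {e \<in> E. e \<subseteq> S}"

lemma finite_nbrs_in: "finite S \<Longrightarrow> finite (nbrs_in E S v)"
  by (auto simp: nbrs_in_def)

lemma simple_edgeE:
  assumes "E \<subseteq> nsets V 2" "e \<in> E"
  obtains u v where "e = {u, v}" "u \<noteq> v" "u \<in> V" "v \<in> V"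
  using assms by (force simp: nsets_def card_2_iff)

lemma simple_edge:
  assumes "E \<subseteq> nsets V 2" "{u, v} \<in> E"
  shows "u \<noteq> v" "u \<in> V" "v \<in> V"
  using assms by (auto elim!: simple_edgeE simp: doubleton_eq_iff)

lemma finite_edges:
  assumes "E \<subseteq> nsets V 2" "finite V"
  shows "finite E"
  using assms by (meson finite_imp_finite_nsets finite_subset)

lemma induced_self: "E \<subseteq> nsets V 2 \<Longrightarrow> induced E V = E"
  by (auto simp: induced_def nsets_def)

lemma induced_simple: "E \<subseteq> nsets V 2 \<Longrightarrow> induced E S \<subseteq> nsets S 2"
  by (auto simp: induced_def nsets_def)

lemma induced_insert:
  assumes "E \<subseteq> nsets V 2"
  shows "induced E (insert w S) = induced E S \<union> (\<lambda>u. {w, u}) ` nbrs_in E S w"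
proof
  show "induced E (insert w S) \<subseteq> induced E S \<union> (\<lambda>u. {w, u}) ` nbrs_in E S w"
  proof
    fix e assume e: "e \<in> induced E (insert w S)"
    then have "e \<in> E" by (simp add: induced_def)
    then obtain u v where uv: "e = {u, v}" "u \<noteq> v"
      using assms simple_edgeE by metis
    show "e \<in> induced E S \<union> (\<lambda>u. {w, u}) ` nbrs_in E S w"
    proof (cases "w \<in> e")
      case True
      then obtain x where "e = {w, x}" "x \<noteq> w"
        using uv by blast
      then show ?thesis
        using e by (auto simp: induced_def nbrs_in_def)
    next
      case False
      then show ?thesis using e by (auto simp: induced_def)
    qed
  qed
qed (auto simp: induced_def nbrs_in_def)

lemma card_induced_insert:
  assumes E: "E \<subseteq> nsets V 2" and "finite S" "w \<notin> S"
  shows "card (induced E (insert w S)) = card (induced E S) + card (nbrs_in E S w)"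
proof -
  have "inj_on (\<lambda>u. {w, u}) (nbrs_in E S w)"
    by (auto simp: inj_on_def doubleton_eq_iff)
  moreover have "induced E S \<inter> (\<lambda>u. {w, u}) ` nbrs_in E S w = {}"
    using assms by (auto simp: induced_def)
  moreover have "finite (induced E S)"
    using finite_edges[OF induced_simple[OF E]] assms by blast
  ultimately show ?thesis
    using assms by (simp add: induced_insert[OF E] card_Un_disjoint card_image finite_nbrs_in)
qed

lemma sum_degrees:
  assumes E: "E \<subseteq> nsets V 2" and "finite S"
  shows "(\<Sum>v\<in>S. card (nbrs_in E S v)) = 2 * card (induced E S)"
  using assms(2)
proof (induction S rule: finite_induct)
  case empty
  have "induced E {} = {}"
    using E by (auto simp: induced_def nsets_def)
  then show ?case by simp
next
  case (insert w S)
  have no_loop: "{w} \<notin> E"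
    using E by (auto simp: nsets_def)
  have "card (nbrs_in E (insert w S) v) = card (nbrs_in E S v) + (if {v, w} \<in> E then 1 else 0)"
    if "v \<in> S" for v
  proof -
    have "nbrs_in E (insert w S) v = nbrs_in E S v \<union> (if {v, w} \<in> E then {w} else {})"
      by (auto simp: nbrs_in_def)
    moreover have "w \<notin> nbrs_in E S v"
      using insert by (auto simp: nbrs_in_def)
    ultimately show ?thesis
      using insert by (auto simp: finite_nbrs_in)
  qed
  then have "(\<Sum>v\<in>S. card (nbrs_in E (insert w S) v))
      = (\<Sum>v\<in>S. card (nbrs_in E S v)) + (\<Sum>v\<in>S. if {v, w} \<in> E then 1 else 0)"
    by (simp add: sum.distrib)
  also have "(\<Sum>v\<in>S. if {v, w} \<in> E then 1 else 0) = card (nbrs_in E S w)"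
    using insert.hyps(1) by (simp add: nbrs_in_def insert_commute flip: sum.inter_filter)
  finally have "(\<Sum>v\<in>S. card (nbrs_in E (insert w S) v))
      = 2 * card (induced E S) + card (nbrs_in E S w)"
    using insert.IH by simp
  moreover have "nbrs_in E (insert w S) w = nbrs_in E S w"
    using no_loop by (auto simp: nbrs_in_def)
  ultimately show ?case
    using insert.hyps card_induced_insert[OF E insert.hyps] by simp
qed

section \<open>Turan's theorem\<close>

text \<open>
  The bound on the clique number is stated for a vertex set and an edge set separately, because the
  proof passes to subsets of both.
\<close>
definition cliques_le :: "nat \<Rightarrow> 'a set \<Rightarrow> 'a set set \<Rightarrow> bool" where
  "cliques_le r V E \<longleftrightarrow> (\<forall>K \<subseteq> V. clique K E \<longrightarrow> card K \<le> r)"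

definition multipartite_edges :: "'a set \<Rightarrow> ('a \<Rightarrow> nat) \<Rightarrow> 'a set set" where
  "multipartite_edges V part = {{u, v} | u v. u \<in> V \<and> v \<in> V \<and> part u \<noteq> part v}"

definition balanced_partition :: "nat \<Rightarrow> 'a set \<Rightarrow> ('a \<Rightarrow> nat) \<Rightarrow> bool" where
  "balanced_partition r V part \<longleftrightarrow> (\<forall>v\<in>V. part v < r) \<and>
     (\<forall>i<r. \<forall>j<r. card {v \<in> V. part v = i} \<le> card {v \<in> V. part v = j} + 1)"

text \<open>
  The number of edges of the Turan graph with \<open>r\<close> parts, built by always adding the next vertex to a
  smallest part: among \<open>m\<close> vertices a smallest part has \<open>m div r\<close> elements, and the new vertex is joined
  to all the others.
\<close>
fun turan_number :: "nat \<Rightarrow> nat \<Rightarrow> nat" where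
  "turan_number r 0 = 0"
| "turan_number r (Suc m) = turan_number r m + (m - m div r)"

lemma turan_graph_iff:
  "turan_graph r m \<lparr>verts = V, edges = E\<rparr> \<longleftrightarrow> E \<subseteq> nsets V 2 \<and> finite V \<and> card V = m \<and>
     (\<exists>part. balanced_partition r V part \<and> E = multipartite_edges V part)"
  by (auto simp: turan_graph_def simple_graph_def balanced_partition_def multipartite_edges_def)

lemma cliques_le_mono: "cliques_le r V E \<Longrightarrow> V' \<subseteq> V \<Longrightarrow> E' \<subseteq> E \<Longrightarrow> cliques_le r V' E'"
  unfolding cliques_le_def clique_def by (meson order_trans subsetD)

lemma multipartite_edges_simple: "multipartite_edges V part \<subseteq> nsets V 2"
  by (auto simp: multipartite_edges_def)

lemma doubleton_in_multipartite_edges: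
  "{u, v} \<in> multipartite_edges V part \<longleftrightarrow> u \<in> V \<and> v \<in> V \<and> part u \<noteq> part v"
  by (auto simp: multipartite_edges_def doubleton_eq_iff)

lemma multipartite_edges_insert:
  assumes "w \<notin> S"
  shows "multipartite_edges (insert w S) (part(w := i))
    = multipartite_edges S part \<union> (\<lambda>u. {w, u}) ` {u \<in> S. part u \<noteq> i}"
  (is "?L = ?R")
proof -
  have star: "{a, b} \<in> (\<lambda>u. {w, u}) ` X \<longleftrightarrow> a = w \<and> b \<in> X \<or> b = w \<and> a \<in> X" for a b X
    by (auto simp: doubleton_eq_iff)
  have "{a, b} \<in> ?L \<longleftrightarrow> {a, b} \<in> ?R" for a b
    unfolding Un_iff star doubleton_in_multipartite_edges using assms by auto
  moreover have "\<exists>a b. e = {a, b}" if "e \<in> ?L \<or> e \<in> ?R" for e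
    using that by (auto simp: multipartite_edges_def)
  ultimately show ?thesis by (metis (no_types, lifting) set_eqI)
qed

lemma card_parts:
  assumes "finite V" "\<forall>v\<in>V. part v < (r :: nat)"
  shows "(\<Sum>i<r. card {v \<in> V. part v = i}) = card V"
  using sum.group[of V "{..<r}" part "\<lambda>_. 1 :: nat"] assms by force

lemma balanced_part_ge:
  assumes "finite V" "balanced_partition r V part" "j < r"
  shows "card V div r \<le> card {v \<in> V. part v = j}"
proof (rule ccontr)
  let ?q = "card V div r"
  assume "\<not> ?thesis"
  then have small: "card {v \<in> V. part v = j} < ?q" by simp
  then have "card {v \<in> V. part v = i} \<le> ?q" if "i < r" for i
    using assms that unfolding balanced_partition_def by fastforce
  then have "(\<Sum>i<r. card {v \<in> V. part v = i}) < (\<Sum>i<r. ?q)"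
    using small assms(3) by (intro sum_strict_mono_ex1) auto
  then have "card V < r * ?q"
    using card_parts[of V part r] assms unfolding balanced_partition_def by simp
  then show False
    by (metis not_less times_div_less_eq_dividend)
qed

lemma exists_small_part:
  assumes "finite V" "\<forall>v\<in>V. part v < r" "0 < r"
  shows "\<exists>i<r. card {v \<in> V. part v = i} \<le> card V div r"
proof (rule ccontr)
  assume "\<not> ?thesis"
  then have "(\<Sum>i<r. Suc (card V div r)) \<le> (\<Sum>i<r. card {v \<in> V. part v = i})"
    by (intro sum_mono) (simp add: Suc_le_eq not_le)
  then have "r * Suc (card V div r) \<le> card V"
    using card_parts[of V part r] assms by simp
  then show False
    using dividend_less_times_div[OF assms(3), of "card V"] by simp
qed

lemma balanced_partition_insert:
  assumes "finite V" "balanced_partition r V part" "w \<notin> V" "i < r"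
    and "card {v \<in> V. part v = i} \<le> card V div r"
  shows "balanced_partition r (insert w V) (part(w := i))"
proof -
  have parts: "card {v \<in> insert w V. (part(w := i)) v = j}
      = card {v \<in> V. part v = j} + (if j = i then 1 else 0)" for j
  proof -
    have "{v \<in> insert w V. (part(w := i)) v = j}
        = {v \<in> V. part v = j} \<union> (if j = i then {w} else {})"
      using assms(3) by auto
    then show ?thesis using assms(1,3) by auto
  qed
  have "card {v \<in> V. part v = i} \<le> card {v \<in> V. part v = j}" if "j < r" for j
    using balanced_part_ge[OF assms(1,2) that] assms(5) by linarith
  then show ?thesis
    using assms(2,4) unfolding balanced_partition_def parts by (auto simp: le_SucI)
qed

lemma exists_turan_graph:
  assumes "finite V" "0 < r"
  shows "\<exists>part. balanced_partition r V part \<and>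
           card (multipartite_edges V part) = turan_number r (card V)"
  using assms(1)
proof (induction V rule: finite_induct)
  case empty
  show ?case by (auto simp: balanced_partition_def multipartite_edges_def)
next
  case (insert w V)
  then obtain part where part: "balanced_partition r V part"
    "card (multipartite_edges V part) = turan_number r (card V)" by blast
  then obtain i where i: "i < r" "card {v \<in> V. part v = i} \<le> card V div r"
    using exists_small_part[of V part r] insert assms unfolding balanced_partition_def by blast
  then have ieq: "card {v \<in> V. part v = i} = card V div r"
    using balanced_part_ge[OF _ part(1) i(1)] insert by fastforce
  have "{u \<in> V. part u \<noteq> i} = V - {v \<in> V. part v = i}" by auto
  then have others: "card {u \<in> V. part u \<noteq> i} = card V - card V div r"
    using insert ieq by (simp add: card_Diff_subset)
  have "inj_on (\<lambda>u. {w, u}) {u \<in> V. part u \<noteq> i}"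
    by (auto simp: inj_on_def doubleton_eq_iff)
  moreover have "multipartite_edges V part \<inter> (\<lambda>u. {w, u}) ` {u \<in> V. part u \<noteq> i} = {}"
    using insert by (auto simp: doubleton_in_multipartite_edges)
  moreover have "finite (multipartite_edges V part)"
    using insert finite_edges multipartite_edges_simple by blast
  ultimately have "card (multipartite_edges (insert w V) (part(w := i)))
      = turan_number r (card V) + (card V - card V div r)"
    using insert part others
    by (simp add: multipartite_edges_insert card_Un_disjoint card_image)
  then show ?case
    using balanced_partition_insert[OF _ part(1) _ i] insert by auto
qed

lemma multipartite_cliques_le:
  assumes "\<forall>v\<in>V. part v < r"
  shows "cliques_le r V (multipartite_edges V part)"
  unfolding cliques_le_def
proof (intro allI impI)
  fix K assume K: "K \<subseteq> V" "clique K (multipartite_edges V part)"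
  then have "inj_on part K"
    unfolding inj_on_def clique_def by (metis doubleton_in_multipartite_edges)
  then have "card K = card (part ` K)" by (simp add: card_image)
  also have "\<dots> \<le> card {..<r}" using K assms by (intro card_mono) auto
  finally show "card K \<le> r" by simp
qed

text \<open>
  Twice the number of edges is the square of the number of vertices minus the sum of the squares of
  the part sizes; \<open>m mod r\<close> parts have size \<open>m div r + 1\<close> and the others have size \<open>m div r\<close>.
\<close>
lemma turan_number_closed_form:
  assumes "0 < r"
  shows "2 * turan_number r m + (r * (m div r)\<^sup>2 + 2 * (m mod r) * (m div r) + m mod r) = m\<^sup>2"
proof (induction m)
  case 0
  then show ?case by simp
next
  case (Suc m)
  define q s where "q = m div r" and "s = m mod r"
  have m: "m = r * q + s" by (simp add: q_def s_def)
  have IH: "2 * turan_number r m + (r * q\<^sup>2 + 2 * s * q + s) = m\<^sup>2"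
    using Suc.IH by (simp add: q_def s_def)
  have le: "q \<le> m" by (simp add: q_def)
  have tS: "2 * turan_number r (Suc m) + 2 * q = 2 * turan_number r m + 2 * m"
    using le by (simp add: q_def[symmetric])
  show ?case
  proof (cases "Suc s = r")
    case True
    then have "Suc m = r * Suc q" using m by simp
    then have d: "Suc m div r = Suc q" "Suc m mod r = 0"
      using assms by (metis nonzero_mult_div_cancel_left not_gr0, metis mod_mult_self1_is_0)
    have r: "r = Suc s" using True by simp
    have "2 * turan_number r (Suc m) + 2 * q + r * (Suc q)\<^sup>2 = (Suc m)\<^sup>2 + 2 * q"
      using IH tS unfolding m r by (simp add: power2_eq_square algebra_simps)
    then show ?thesis unfolding d by simp
  next
    case False
    then have "Suc s < r" using assms by (simp add: s_def Suc_lessI)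
    moreover have "Suc m = r * q + Suc s" using m by simp
    ultimately have d: "Suc m div r = q" "Suc m mod r = Suc s"
      by (simp_all add: div_mult_self4 \<open>Suc m = r * q + Suc s\<close> del: add_Suc_right)
    have "2 * turan_number r (Suc m) + 2 * q + (r * q\<^sup>2 + 2 * Suc s * q + Suc s) = (Suc m)\<^sup>2 + 2 * q"
      using IH tS by (simp add: power2_eq_square algebra_simps)
    then show ?thesis unfolding d by simp
  qed
qed

text \<open>
  The degrees in a Turan graph on \<open>m + 1\<close> vertices differ by at most one and the smallest of them is
  \<open>m - m div r\<close>, so the average degree is below \<open>m - m div r + 1\<close>.  Hence every graph with that many
  edges has a vertex whose deletion costs at most \<open>m - m div r\<close> edges.
\<close>
lemma turan_number_average_degree:
  assumes "0 < r"
  shows "2 * turan_number r (Suc m) < Suc m * Suc (m - m div r)"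
proof -
  define q s where "q = m div r" and "s = m mod r"
  have m: "m = r * q + s" by (simp add: q_def s_def)
  have le: "q \<le> m" by (simp add: q_def)
  have "2 * turan_number r (Suc m) + 2 * q = 2 * turan_number r m + 2 * m"
    using le by (simp add: q_def[symmetric])
  moreover have "2 * turan_number r m + (r * q\<^sup>2 + 2 * s * q + s) = m\<^sup>2"
    using turan_number_closed_form[OF assms, of m] by (simp add: q_def s_def)
  moreover have "s < r" using assms by (simp add: s_def)
  moreover have "m\<^sup>2 + 2 * m < Suc m * Suc m" by (simp add: power2_eq_square)
  moreover have "Suc m * q \<le> 2 * q + (r * q\<^sup>2 + 2 * s * q + s)"
    unfolding m by (simp add: power2_eq_square algebra_simps)
  moreover have "Suc m * Suc (m - q) + Suc m * q = Suc m * Suc m"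
    using le by (metis Suc_diff_le add_mult_distrib2 le_SucI le_add_diff_inverse2)
  ultimately show ?thesis unfolding q_def[symmetric] by linarith
qed

text \<open>
  Uniqueness implies the bound.  Were there more edges, keep just enough of them; what is kept is a
  Turan graph, and an additional edge lies inside one of its parts.  The ends of that edge and one vertex
  of every other part form a clique on \<open>r + 1\<close> vertices.
\<close>
lemma turan_bound_of_uniqueness:
  assumes V: "finite V" and E: "E \<subseteq> nsets V 2" "cliques_le r V E" and r: "0 < r"
    and unique: "\<And>E'. E' \<subseteq> E \<Longrightarrow> card E' = turan_number r (card V) \<Longrightarrow>
      \<exists>part. balanced_partition r V part \<and> E' = multipartite_edges V part"
  shows "card E \<le> turan_number r (card V)"
proof (rule ccontr)
  assume "\<not> ?thesis"
  then have gt: "turan_number r (card V) < card E" by simp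
  then obtain E' where E': "E' \<subseteq> E" "card E' = turan_number r (card V)"
    by (meson less_imp_le obtain_subset_with_card_n)
  then obtain part where part: "balanced_partition r V part" "E' = multipartite_edges V part"
    using unique by blast
  obtain e where e: "e \<in> E" "e \<notin> E'"
    using E' gt by (metis less_irrefl subsetI subset_antisym)
  then obtain u v where uv: "e = {u, v}" "u \<noteq> v" "u \<in> V" "v \<in> V"
    using simple_edgeE[OF E(1)] by metis
  then have same: "part u = part v"
    using e part by (auto simp: doubleton_in_multipartite_edges)
  have pu: "part u < r" using part uv by (auto simp: balanced_partition_def)
  have "\<exists>x\<in>V. part x = j" if "j < r" for j
  proof -
    have "card {u, v} \<le> card {x \<in> V. part x = part u}"
      using uv same V by (intro card_mono) auto
    then have "2 \<le> card {x \<in> V. part x = j} + 1"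
      using part(1) that pu uv(2) unfolding balanced_partition_def by fastforce
    then have "{x \<in> V. part x = j} \<noteq> {}" by (metis card.empty not_less_eq_eq numeral_2_eq_2 add_0 One_nat_def order_refl)
    then show ?thesis by blast
  qed
  then obtain g where g: "\<And>j. j < r \<Longrightarrow> g j \<in> V \<and> part (g j) = j" by metis
  let ?K = "insert u (insert v (g ` ({..<r} - {part u})))"
  have "clique ?K E"
  proof -
    have "{a, b} \<in> E" if "a \<in> ?K" "b \<in> ?K" "a \<noteq> b" for a b
    proof (cases "{a, b} = {u, v}")
      case True
      then show ?thesis using e uv by simp
    next
      case False
      then have "part a \<noteq> part b"
        using that same g by auto
      moreover have "a \<in> V" "b \<in> V" using that g uv by auto
      ultimately show ?thesis
        using E'(1) unfolding part by (auto simp: doubleton_in_multipartite_edges)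
    qed
    then show ?thesis by (auto simp: clique_def)
  qed
  moreover have "?K \<subseteq> V" using g uv by auto
  ultimately have "card ?K \<le> r" using E by (auto simp: cliques_le_def)
  moreover have "card ?K = Suc (Suc (r - 1))"
  proof -
    have "inj_on g ({..<r} - {part u})"
      using g by (metis DiffD1 inj_onI lessThan_iff)
    then have "card (g ` ({..<r} - {part u})) = r - 1"
      using pu by (simp add: card_image)
    moreover have "u \<notin> g ` ({..<r} - {part u})" "v \<notin> g ` ({..<r} - {part u})"
      using g same by auto
    ultimately show ?thesis using uv by simp
  qed
  ultimately show False using r by simp
qed

text \<open>
  Induction on the number of vertices.  Deleting a vertex \<open>w\<close> of small degree leaves at least
  the extremal number of edges, hence a Turan graph.  As \<open>w\<close> cannot have neighbours in all parts, it
  misses one part completely, and counting forces that part to be a smallest one and \<open>w\<close> to be joined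
  to everything else.
\<close>
lemma turan_theorem_aux:
  assumes "0 < r"
  shows "finite V \<Longrightarrow> card V = m \<Longrightarrow> E \<subseteq> nsets V 2 \<Longrightarrow> cliques_le r V E \<Longrightarrow>
    card E = turan_number r m \<Longrightarrow>
    \<exists>part. balanced_partition r V part \<and> E = multipartite_edges V part"
proof (induction m arbitrary: V E)
  case 0
  then have "V = {}" "E = {}"
    by (auto simp: nsets_def)
  then show ?case by (auto simp: balanced_partition_def multipartite_edges_def)
next
  case (Suc m)
  have "\<exists>w\<in>V. card (nbrs_in E V w) \<le> m - m div r"
  proof (rule ccontr)
    assume "\<not> ?thesis"
    then have "(\<Sum>w\<in>V. Suc (m - m div r)) \<le> (\<Sum>w\<in>V. card (nbrs_in E V w))"
      by (intro sum_mono) (simp add: not_le Suc_le_eq)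
    also have "\<dots> = 2 * turan_number r (Suc m)"
      using sum_degrees[OF Suc.prems(3,1)] Suc.prems by (simp add: induced_self)
    finally show False
      using turan_number_average_degree[OF assms, of m] Suc.prems by simp
  qed
  then obtain w where w: "w \<in> V" "card (nbrs_in E V w) \<le> m - m div r" by blast
  define S where "S = V - {w}"
  have S: "V = insert w S" "w \<notin> S" "finite S" "card S = m"
    using w Suc.prems by (auto simp: S_def)
  have "nbrs_in E V w = nbrs_in E S w"
    using Suc.prems(3) by (auto simp: nbrs_in_def S nsets_def)
  with w have deg: "card (nbrs_in E S w) \<le> m - m div r" by simp
  have count: "turan_number r (Suc m) = card (induced E S) + card (nbrs_in E S w)"
    using card_induced_insert[OF Suc.prems(3) S(3,2)] Suc.prems induced_self[OF Suc.prems(3)]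
    by (simp add: S(1))
  have ind: "induced E S \<subseteq> nsets S 2" "cliques_le r S (induced E S)"
    using Suc.prems induced_simple cliques_le_mono
    by (blast, metis S(1) induced_def mem_Collect_eq subsetI subset_insertI)
  have "card (induced E S) \<le> turan_number r (card S)"
  proof (rule turan_bound_of_uniqueness[OF S(3) ind assms])
    fix E' assume "E' \<subseteq> induced E S" "card E' = turan_number r (card S)"
    then show "\<exists>part. balanced_partition r S part \<and> E' = multipartite_edges S part"
      using ind S cliques_le_mono[of r S _ S E'] by (intro Suc.IH) auto
  qed
  then have eqs: "card (induced E S) = turan_number r m" "card (nbrs_in E S w) = m - m div r"
    using count deg unfolding S(4) turan_number.simps by linarith+
  then obtain part where part: "balanced_partition r S part" "induced E S = multipartite_edges S part"
    using Suc.IH[OF S(3,4) ind] by blast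
  have "\<exists>i<r. \<forall>u\<in>S. part u = i \<longrightarrow> {w, u} \<notin> E"
  proof (rule ccontr)
    assume "\<not> ?thesis"
    then obtain g where g: "\<And>i. i < r \<Longrightarrow> g i \<in> S \<and> part (g i) = i \<and> {w, g i} \<in> E"
      by metis
    have "clique (insert w (g ` {..<r})) E"
    proof -
      have "{g i, g j} \<in> E" if "i < r" "j < r" "i \<noteq> j" for i j
      proof -
        have "{g i, g j} \<in> induced E S"
          unfolding part doubleton_in_multipartite_edges using g that by simp
        then show ?thesis by (simp add: induced_def)
      qed
      moreover have "i \<noteq> j" if "g i \<noteq> g j" for i j using that by blast
      moreover have "{w, g i} \<in> E" "{g i, w} \<in> E" if "i < r" for i
        using g[OF that] by (simp_all add: insert_commute)
      ultimately show ?thesis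
        unfolding clique_def by blast
    qed
    moreover have "insert w (g ` {..<r}) \<subseteq> V" using g S by auto
    ultimately have "card (insert w (g ` {..<r})) \<le> r"
      using Suc.prems by (auto simp: cliques_le_def)
    moreover have "inj_on g {..<r}" using g by (metis inj_onI lessThan_iff)
    moreover have "w \<notin> g ` {..<r}" using g S by auto
    ultimately show False by (simp add: card_image)
  qed
  then obtain i where i: "i < r" "\<forall>u\<in>S. part u = i \<longrightarrow> {w, u} \<notin> E" by blast
  have sub: "nbrs_in E S w \<subseteq> {u \<in> S. part u \<noteq> i}"
    using i by (auto simp: nbrs_in_def)
  have "{u \<in> S. part u \<noteq> i} = S - {u \<in> S. part u = i}" by auto
  then have "card {u \<in> S. part u \<noteq> i} = m - card {u \<in> S. part u = i}"
    using S by (simp add: card_Diff_subset)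
  moreover have "m div r \<le> card {u \<in> S. part u = i}"
    using balanced_part_ge[OF S(3) part(1) i(1)] S by simp
  moreover have "card (nbrs_in E S w) \<le> card {u \<in> S. part u \<noteq> i}"
    using sub S by (intro card_mono) auto
  moreover have "card {u \<in> S. part u = i} \<le> m"
    using S by (metis (no_types, lifting) card_mono mem_Collect_eq subsetI)
  moreover have "m div r \<le> m" by simp
  ultimately have "card {u \<in> S. part u = i} \<le> m div r" "card (nbrs_in E S w) = card {u \<in> S. part u \<noteq> i}"
    using eqs(2) by linarith+
  then have "nbrs_in E S w = {u \<in> S. part u \<noteq> i}"
    using sub S by (intro card_subset_eq) auto
  then have "E = multipartite_edges V (part(w := i))"
    using induced_insert[OF Suc.prems(3), of w S] induced_self[OF Suc.prems(3)] part(2)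
    by (simp add: S(1) multipartite_edges_insert[OF S(2)])
  moreover have "balanced_partition r V (part(w := i))"
    unfolding S(1) using \<open>card {u \<in> S. part u = i} \<le> m div r\<close> S
    by (intro balanced_partition_insert part(1) i(1)) auto
  ultimately show ?case by blast
qed

theorem turan_unique:
  assumes "0 < r" "finite V" "E \<subseteq> nsets V 2" "cliques_le r V E"
    and "card E = turan_number r (card V)"
  shows "\<exists>part. balanced_partition r V part \<and> E = multipartite_edges V part"
  using turan_theorem_aux assms by blast

theorem turan_bound:
  assumes "0 < r" "finite V" "E \<subseteq> nsets V 2" "cliques_le r V E"
  shows "card E \<le> turan_number r (card V)"
proof (rule turan_bound_of_uniqueness[OF assms(2-4,1)])
  fix E' assume "E' \<subseteq> E" "card E' = turan_number r (card V)"
  then show "\<exists>part. balanced_partition r V part \<and> E' = multipartite_edges V part"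
    using assms cliques_le_mono[of r V E V E'] by (intro turan_unique) auto
qed

section \<open>Signs of walks and cycles\<close>

abbreviation walk :: "'a set set \<Rightarrow> 'a list \<Rightarrow> bool" where
  "walk E \<equiv> successively (\<lambda>u v. {u, v} \<in> E)"

definition is_path :: "'a set set \<Rightarrow> 'a list \<Rightarrow> bool" where
  "is_path E p \<longleftrightarrow> p \<noteq> [] \<and> distinct p \<and> walk E p"

fun walk_sign :: "('a set \<Rightarrow> int) \<Rightarrow> 'a list \<Rightarrow> int" where
  "walk_sign \<sigma> (x # y # zs) = \<sigma> {x, y} * walk_sign \<sigma> (y # zs)"
| "walk_sign \<sigma> zs = 1"

text \<open>
  Negative cycles in terms of closed walks: the vertex list is closed up by repeating its first
  element, so that signs and edges can be split along concatenations of lists.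
\<close>
definition neg_cycle :: "'a set set \<Rightarrow> ('a set \<Rightarrow> int) \<Rightarrow> 'a list \<Rightarrow> bool" where
  "neg_cycle E \<sigma> xs \<longleftrightarrow> 3 \<le> length xs \<and> distinct xs \<and>
     walk E (xs @ [hd xs]) \<and> walk_sign \<sigma> (xs @ [hd xs]) = - 1"

lemma walk_sign_append: "walk_sign \<sigma> (xs @ y # ys) = walk_sign \<sigma> (xs @ [y]) * walk_sign \<sigma> (y # ys)"
proof (induction xs)
  case (Cons x xs)
  then show ?case by (cases xs) auto
qed simp

lemma walk_sign_snoc: "walk_sign \<sigma> (xs @ [y, z]) = walk_sign \<sigma> (xs @ [y]) * \<sigma> {y, z}"
  using walk_sign_append[of \<sigma> xs y "[z]"] by simp

lemma walk_sign_rev: "walk_sign \<sigma> (rev xs) = walk_sign \<sigma> xs"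
proof (induction xs rule: induct_list012)
  case (3 x y zs)
  then show ?case by (simp add: walk_sign_snoc insert_commute)
qed auto

lemma walk_rev: "walk E (rev p) \<longleftrightarrow> walk E p"
  by (simp add: insert_commute)

lemma is_path_rev: "is_path E (rev p) \<longleftrightarrow> is_path E p"
  by (simp add: is_path_def insert_commute)

lemma walk_append: "walk E (xs @ y # ys) \<longleftrightarrow> walk E (xs @ [y]) \<and> walk E (y # ys)"
  by (auto simp: successively_append_iff)

lemma walk_sign_unit:
  assumes "\<forall>e\<in>E. \<sigma> e \<in> {1, - 1}" "walk E p"
  shows "walk_sign \<sigma> p \<in> {1, - 1}"
  using assms(2)
proof (induction p rule: induct_list012)
  case (3 x y zs)
  then show ?case using assms(1) by auto
qed auto

lemma walk_sign_conv_prod: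
  "walk_sign \<sigma> p = (\<Prod>i<length p - 1. \<sigma> {p ! i, p ! Suc i})"
  by (induction p rule: induct_list012) (auto simp: prod.lessThan_Suc_shift simp del: prod.lessThan_Suc)

lemma closed_walk_nth:
  assumes "i < length xs"
  shows "(xs @ [hd xs]) ! i = xs ! i" "(xs @ [hd xs]) ! Suc i = xs ! (Suc i mod length xs)"
  using assms hd_conv_nth[of xs] by (cases "xs = []"; auto simp: nth_append mod_Suc)+

lemma cycle_edges_conv_image:
  "cycle_edges xs = (\<lambda>i. {xs ! i, xs ! (Suc i mod length xs)}) ` {..<length xs}"
  by (auto simp: cycle_edges_def)

lemma cycle_edges_subset_iff: "cycle_edges xs \<subseteq> E \<longleftrightarrow> walk E (xs @ [hd xs])"
  unfolding successively_conv_nth cycle_edges_conv_image image_subset_iff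
  using closed_walk_nth[of _ xs] by auto

lemma cycle_edges_inj:
  assumes "3 \<le> length xs" "distinct xs"
  shows "inj_on (\<lambda>i. {xs ! i, xs ! (Suc i mod length xs)}) {..<length xs}"
proof (rule inj_onI, rule ccontr)
  fix i j
  assume ij: "i \<in> {..<length xs}" "j \<in> {..<length xs}" "i \<noteq> j"
    and eq: "{xs ! i, xs ! (Suc i mod length xs)} = {xs ! j, xs ! (Suc j mod length xs)}"
  have "Suc i mod length xs < length xs" "Suc j mod length xs < length xs"
    using assms by (auto intro: mod_less_divisor)
  then have "i = Suc j mod length xs" "j = Suc i mod length xs"
    using eq ij assms(2) by (auto simp: doubleton_eq_iff nth_eq_iff_index_eq)
  moreover have "Suc k mod length xs = (if Suc k = length xs then 0 else Suc k)"
    if "k < length xs" for k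
    using that by (metis Suc_lessI mod_less mod_self)
  ultimately show False
    using ij assms(1) by (auto split: if_splits)
qed

lemma cycle_sign_conv_walk_sign:
  assumes "3 \<le> length xs" "distinct xs"
  shows "(\<Prod>e\<in>cycle_edges xs. \<sigma> e) = walk_sign \<sigma> (xs @ [hd xs])"
  unfolding cycle_edges_conv_image prod.reindex[OF cycle_edges_inj[OF assms]] walk_sign_conv_prod
  using closed_walk_nth[of _ xs] by (intro prod.cong) auto

lemma walk_vertices:
  assumes "E \<subseteq> nsets V 2" "walk E p" "2 \<le> length p"
  shows "set p \<subseteq> V"
  using assms(2,3)
proof (induction p rule: induct_list012)
  case (3 x y zs)
  then show ?case
    using simple_edge[OF assms(1), of x y] by (cases zs) auto
qed auto

lemma neg_cycle_vertices:
  assumes "E \<subseteq> nsets V 2" "neg_cycle E \<sigma> xs"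
  shows "set xs \<subseteq> V"
  using walk_vertices[OF assms(1), of "xs @ [hd xs]"] assms(2) by (auto simp: neg_cycle_def)

lemma negative_cycle_iff:
  assumes "simple_graph G"
  shows "negative_cycle G xs \<longleftrightarrow> neg_cycle (edges G) (sign G) xs"
  using cycle_sign_conv_walk_sign[of xs "sign G"] neg_cycle_vertices[of "edges G" "verts G" "sign G" xs] assms
  by (auto simp: negative_cycle_def is_cycle_def cycle_sign_def neg_cycle_def cycle_edges_subset_iff
      simple_graph_def)

lemma neg_cycle_rotate:
  assumes "neg_cycle E \<sigma> (A @ B)"
  shows "neg_cycle E \<sigma> (B @ A)"
proof (cases "A = [] \<or> B = []")
  case True
  then show ?thesis using assms by auto
next
  case False
  then obtain a A' b B' where ab: "A = a # A'" "B = b # B'"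
    by (meson neq_Nil_conv)
  have "walk_sign \<sigma> (a # A' @ b # B' @ [a]) = walk_sign \<sigma> (b # B' @ a # A' @ [b])"
    using walk_sign_append[of \<sigma> "a # A'" b "B' @ [a]"] walk_sign_append[of \<sigma> "b # B'" a "A' @ [b]"]
    by simp
  moreover have "walk E (a # A' @ b # B' @ [a]) \<longleftrightarrow> walk E (b # B' @ a # A' @ [b])"
    using walk_append[of E "a # A'" b "B' @ [a]"] walk_append[of E "b # B'" a "A' @ [b]"]
    by auto
  ultimately show ?thesis
    using assms by (auto simp: neg_cycle_def ab)
qed

lemma neg_cycle_mono:
  assumes "neg_cycle E \<sigma> xs" "E \<subseteq> E'"
  shows "neg_cycle E' \<sigma> xs"
  using assms unfolding neg_cycle_def by (meson subsetD successively_mono)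

section \<open>Long ears of negative cycles\<close>

text \<open>
  The three paths between \<open>u\<close> and \<open>v\<close> form a theta graph.  The signs of the two arcs of \<open>Z\<close> differ, so
  the sign of the third path differs from one of them and closes a negative cycle with that arc.
\<close>
lemma theta_negative_cycle:
  assumes signs: "\<forall>e\<in>E. \<sigma> e \<in> {1, - 1}"
    and Z: "neg_cycle E \<sigma> (u # M @ v # D)"
    and P: "is_path E (u # Q @ [v])"
    and disj: "set Q \<inter> set (u # M @ v # D) = {}" and "Q \<noteq> []"
  shows "neg_cycle E \<sigma> (u # M @ v # rev Q) \<or> neg_cycle E \<sigma> (u # Q @ v # D)"
proof -
  define a b c where "a = walk_sign \<sigma> (u # M @ [v])" and "b = walk_sign \<sigma> (v # D @ [u])"
    and "c = walk_sign \<sigma> (u # Q @ [v])"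
  have walks: "walk E (u # M @ [v])" "walk E (v # D @ [u])" "walk E (u # Q @ [v])"
    using Z P walk_append[of E "u # M" v "D @ [u]"] by (auto simp: neg_cycle_def is_path_def)
  have rev: "walk_sign \<sigma> (v # rev Q @ [u]) = c" "walk E (v # rev Q @ [u])"
    using walk_sign_rev[of \<sigma> "u # Q @ [v]"] walk_rev[of E "u # Q @ [v]"] walks(3)
    by (simp_all add: c_def)
  have ab: "a * b = - 1"
    using Z walk_sign_append[of \<sigma> "u # M" v "D @ [u]"] by (simp add: a_def b_def neg_cycle_def)
  have c: "c \<in> {1, - 1}"
    using walk_sign_unit[OF signs walks(3)] by (simp add: c_def)
  have lens: "3 \<le> length (u # M @ v # rev Q)" "3 \<le> length (u # Q @ v # D)"
    using \<open>Q \<noteq> []\<close> by (cases Q; simp)+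
  have dist: "distinct (u # M @ v # rev Q)" "distinct (u # Q @ v # D)"
    using Z P disj by (auto simp: neg_cycle_def is_path_def)
  have w1: "walk E (u # M @ v # rev Q @ [u])" "walk_sign \<sigma> (u # M @ v # rev Q @ [u]) = a * c"
    using walk_append[of E "u # M" v "rev Q @ [u]"] walk_sign_append[of \<sigma> "u # M" v "rev Q @ [u]"]
      walks rev by (simp_all add: a_def)
  have w2: "walk E (u # Q @ v # D @ [u])" "walk_sign \<sigma> (u # Q @ v # D @ [u]) = c * b"
    using walk_append[of E "u # Q" v "D @ [u]"] walk_sign_append[of \<sigma> "u # Q" v "D @ [u]"] walks
    by (simp_all add: b_def c_def)
  have "a * c = - 1 \<or> c * b = - 1"
    using ab c walk_sign_unit[OF signs walks(1)] walk_sign_unit[OF signs walks(2)]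
    unfolding a_def[symmetric] b_def[symmetric] by auto
  then show ?thesis
    using lens dist w1 w2 by (auto simp: neg_cycle_def)
qed

text \<open>
  Each of the two cycles through a long ear would be long, and one of them negative.
\<close>
lemma no_long_ear:
  assumes signs: "\<forall>e\<in>E. \<sigma> e \<in> {1, - 1}"
    and short: "\<And>xs. neg_cycle E \<sigma> xs \<Longrightarrow> length xs < l"
    and Z: "neg_cycle E \<sigma> Z" and uv: "u \<in> set Z" "v \<in> set Z"
    and P: "is_path E (u # Q @ [v])" and disj: "set Q \<inter> set Z = {}"
  shows "length Q < l"
proof (rule ccontr)
  assume long: "\<not> length Q < l"
  have "0 < l" using short[OF Z] by simp
  then have Q: "Q \<noteq> []" using long by auto
  obtain A D where Z_eq: "Z = A @ u # D"
    using uv(1) by (meson split_list)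
  have "neg_cycle E \<sigma> (u # D @ A)"
    using neg_cycle_rotate[of E \<sigma> A "u # D"] Z by (simp add: Z_eq)
  moreover have "v \<in> set (D @ A)"
    using uv P by (auto simp: Z_eq is_path_def)
  then obtain M D' where "D @ A = M @ v # D'"
    by (meson split_list)
  ultimately have Z': "neg_cycle E \<sigma> (u # M @ v # D')" by simp
  moreover have "set Q \<inter> set (u # M @ v # D') = {}"
    using disj arg_cong[OF \<open>D @ A = M @ v # D'\<close>, of set] by (auto simp: Z_eq)
  ultimately have "neg_cycle E \<sigma> (u # M @ v # rev Q) \<or> neg_cycle E \<sigma> (u # Q @ v # D')"
    using theta_negative_cycle[OF signs Z' P _ Q] by blast
  then have "length (u # M @ v # rev Q) < l \<or> length (u # Q @ v # D') < l"
    using short by blast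
  then show False using long by auto
qed

text \<open>
  The vertices of \<open>Z\<close> cut the path into fewer than \<open>card (set p \<inter> Z)\<close> gaps.  A path that is long
  compared to the number of its visits to \<open>Z\<close> therefore has a long gap.
\<close>
lemma exists_long_gap:
  assumes "is_path E p" "hd p \<in> Z" "last p \<in> Z" "l * card (set p \<inter> Z) < length p" "0 < l"
  shows "\<exists>u Q v. u \<in> Z \<and> v \<in> Z \<and> is_path E (u # Q @ [v]) \<and> set Q \<inter> Z = {} \<and> l \<le> length Q"
  using assms(1-4)
proof (induction p rule: length_induct)
  case (1 p)
  obtain x R where p: "p = x # R"
    using 1(2) by (cases p) (auto simp: is_path_def)
  have R: "R \<noteq> []"
  proof
    assume "R = []"
    then have "set p \<inter> Z = {x}" using 1(3) p by auto
    then show False using 1(5) p \<open>R = []\<close> assms(5) by simp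
  qed
  then have "\<exists>y\<in>set R. y \<in> Z"
    using last_in_set[OF R] 1(4) by (auto simp: p)
  then obtain Q y R' where split: "R = Q @ y # R'" "y \<in> Z" "\<forall>q\<in>set Q. q \<notin> Z"
    using split_list_first_prop[of R "\<lambda>y. y \<in> Z"] by blast
  have path1: "is_path E (x # Q @ [y])"
    using 1(2) walk_append[of E "x # Q" y R'] by (auto simp: p split is_path_def)
  have path2: "is_path E (y # R')"
    using 1(2) walk_append[of E "x # Q" y R'] by (auto simp: p split is_path_def)
  show ?case
  proof (cases "l \<le> length Q")
    case True
    then show ?thesis
      using path1 split 1(3) p by (intro exI[of _ x] exI[of _ Q] exI[of _ y]) auto
  next
    case False
    have "set p \<inter> Z = insert x (set (y # R') \<inter> Z)" "x \<notin> set (y # R') \<inter> Z"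
      using 1(2,3) split by (auto simp: p is_path_def)
    then have "card (set p \<inter> Z) = Suc (card (set (y # R') \<inter> Z))" by simp
    then have gap: "l * card (set (y # R') \<inter> Z) < length (y # R')"
      using 1(5) False by (simp add: p split)
    have last: "last (y # R') \<in> Z" using 1(4) by (simp add: p split)
    have hd: "hd (y # R') \<in> Z" using split by simp
    have shorter: "length (y # R') < length p" by (simp add: p split)
    show ?thesis
      using 1(1)[rule_format, OF shorter path2 hd last gap] .
  qed
qed

section \<open>Linked vertex sets\<close>

text \<open>
  The paths are not asked to avoid any vertices: their length alone makes them contain a long ear of
  every short cycle through both ends.
\<close>
definition linked :: "'a set set \<Rightarrow> nat \<Rightarrow> 'a set \<Rightarrow> bool" where
  "linked E L S \<longleftrightarrow> (\<forall>u\<in>S. \<forall>v\<in>S. u \<noteq> v \<longrightarrow>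
     (\<exists>p. is_path E p \<and> hd p = u \<and> last p = v \<and> set p \<subseteq> S \<and> L \<le> length p))"

text \<open>
  A new vertex with two neighbours in \<open>S\<close> can reach every \<open>v \<in> S\<close>: the first step goes to a neighbour
  other than \<open>v\<close>.
\<close>
lemma linked_insert:
  assumes S: "linked E L S" and w: "w \<notin> S" and ab: "a \<in> nbrs_in E S w" "b \<in> nbrs_in E S w" "a \<noteq> b"
  shows "linked E L (insert w S)"
proof -
  have from_w: "\<exists>p. is_path E p \<and> hd p = w \<and> last p = v \<and> set p \<subseteq> insert w S \<and> L \<le> length p"
    if v: "v \<in> S" for v
  proof -
    obtain c where c: "c \<in> nbrs_in E S w" "c \<noteq> v" using ab by metis
    then have "c \<in> S" by (simp add: nbrs_in_def)
    then obtain p where p: "is_path E p" "hd p = c" "last p = v" "set p \<subseteq> S" "L \<le> length p"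
      using S[unfolded linked_def, rule_format, OF _ v c(2)] by blast
    then have "is_path E (w # p)"
      using c w by (auto simp: is_path_def nbrs_in_def successively_Cons)
    then show ?thesis
      using p by (intro exI[of _ "w # p"]) (auto simp: is_path_def)
  qed
  have to_w: "\<exists>p. is_path E p \<and> hd p = v \<and> last p = w \<and> set p \<subseteq> insert w S \<and> L \<le> length p"
    if v: "v \<in> S" for v
  proof -
    from from_w[OF v] obtain p where "is_path E p" "hd p = w" "last p = v"
      "set p \<subseteq> insert w S" "L \<le> length p" by blast
    then show ?thesis
      by (intro exI[of _ "rev p"]) (auto simp: is_path_rev hd_rev last_rev)
  qed
  have in_S: "\<exists>p. is_path E p \<and> hd p = u \<and> last p = v \<and> set p \<subseteq> insert w S \<and> L \<le> length p"
    if "u \<in> S" "v \<in> S" "u \<noteq> v" for u v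
    using S[unfolded linked_def, rule_format, OF that] by blast
  show ?thesis
    unfolding linked_def using from_w to_w in_S by auto
qed

text \<open>
  Two common vertices would be joined by a path on at least \<open>l * l\<close> vertices.  The cycle has fewer
  than \<open>l\<close> vertices, so the path makes a long excursion outside the cycle, which is a long ear.
\<close>
lemma negative_cycle_meets_linked_set:
  assumes signs: "\<forall>e\<in>E. \<sigma> e \<in> {1, - 1}"
    and short: "\<And>xs. neg_cycle E \<sigma> xs \<Longrightarrow> length xs < l"
    and Z: "neg_cycle E \<sigma> Z" and S: "linked E (l * l) S"
  shows "card (set Z \<inter> S) \<le> 1"
proof (rule ccontr)
  assume "\<not> ?thesis"
  then obtain u v where uv: "u \<in> set Z \<inter> S" "v \<in> set Z \<inter> S" "u \<noteq> v"
    using card_le_Suc0_iff_eq[of "set Z \<inter> S"] by auto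
  then obtain p where p: "is_path E p" "hd p = u" "last p = v" "l * l \<le> length p"
    using S[unfolded linked_def, rule_format, of u v] by blast
  have "card (set p \<inter> set Z) \<le> card (set Z)"
    by (intro card_mono) auto
  also have "\<dots> \<le> length Z" by (rule card_length)
  also have "\<dots> < l" using short[OF Z] .
  finally have "l * card (set p \<inter> set Z) < l * l" by simp
  then have "l * card (set p \<inter> set Z) < length p" "0 < l" using p(4) by (linarith, simp)
  then obtain x Q y where "x \<in> set Z" "y \<in> set Z" "is_path E (x # Q @ [y])" "set Q \<inter> set Z = {}" "l \<le> length Q"
    using exists_long_gap[of E p "set Z" l] p uv by auto
  then show False
    using no_long_ear[OF signs short Z, of x y Q] by auto
qed

lemma exists_greedy_path:
  assumes E: "E \<subseteq> nsets V 2"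
    and deg: "\<And>x. x \<in> S \<Longrightarrow> L \<le> card (nbrs_in E S x)" and S: "finite S" "u \<in> S" "u \<noteq> v"
  shows "1 \<le> k \<Longrightarrow> k \<le> L \<Longrightarrow>
    \<exists>p. is_path E p \<and> last p = u \<and> set p \<subseteq> S - {v} \<and> length p = k"
proof (induction k rule: nat_induct_at_least[of 1])
  case base
  show ?case using S by (intro exI[of _ "[u]"]) (auto simp: is_path_def)
next
  case (Suc k)
  then obtain p where p: "is_path E p" "last p = u" "set p \<subseteq> S - {v}" "length p = k"
    by auto
  have hd: "hd p \<in> set p" using p by (simp add: is_path_def)
  have "card (insert v (set p - {hd p})) \<le> Suc (card (set p - {hd p}))"
    by (simp add: card_insert_if)
  also have "\<dots> = k"
    using hd p Suc.hyps by (auto simp: is_path_def distinct_card)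
  also have "k < card (nbrs_in E S (hd p))"
    using deg[of "hd p"] hd p Suc.prems by auto
  finally have "\<not> nbrs_in E S (hd p) \<subseteq> insert v (set p - {hd p})"
    by (metis card_mono finite.insertI finite_Diff List.finite_set leD)
  then obtain x where x: "x \<in> nbrs_in E S (hd p)" "x \<noteq> v" "x \<notin> set p - {hd p}" by auto
  then have "x \<notin> set p"
    using simple_edge(1)[OF E] by (auto simp: nbrs_in_def)
  then have "is_path E (x # p)"
    using p x by (auto simp: is_path_def nbrs_in_def successively_Cons insert_commute)
  then show ?case
    using p x by (intro exI[of _ "x # p"]) (auto simp: nbrs_in_def is_path_def)
qed

text \<open>
  If all vertices see clearly more than half of \<open>S\<close>, a path starting at \<open>u\<close> can be extended greedily
  up to the desired length, and then its end still has a common neighbour with \<open>v\<close> off the path.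
\<close>
lemma linked_of_min_degree:
  assumes E: "E \<subseteq> nsets V 2" and S: "finite S"
    and deg: "\<And>x. x \<in> S \<Longrightarrow> card S + L + 3 \<le> 2 * card (nbrs_in E S x)"
  shows "linked E L S"
  unfolding linked_def
proof (intro ballI impI)
  fix v u assume vu: "v \<in> S" "u \<in> S" "v \<noteq> u"
  have le: "card (nbrs_in E S x) \<le> card S" for x
    using S by (intro card_mono) (auto simp: nbrs_in_def)
  have deg': "Suc L \<le> card (nbrs_in E S x)" if "x \<in> S" for x
    using deg[OF that] le[of x] by linarith
  obtain p where p: "is_path E p" "last p = u" "set p \<subseteq> S - {v}" "length p = Suc L"
    using exists_greedy_path[OF E deg' S vu(2) vu(3)[symmetric], of "Suc L"] by auto
  have hd: "hd p \<in> S" using p hd_in_set[of p] unfolding is_path_def by blast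
  let ?N = "nbrs_in E S (hd p) \<inter> nbrs_in E S v"
  have "card (nbrs_in E S (hd p) \<union> nbrs_in E S v) \<le> card S"
    using S by (intro card_mono) (auto simp: nbrs_in_def)
  then have "Suc L < card ?N"
    using card_Un_Int[of "nbrs_in E S (hd p)" "nbrs_in E S v"] deg[OF hd] deg[OF vu(1)] S
    by (simp add: finite_nbrs_in)
  then have "card (set p) < card ?N"
    using card_length[of p] p(4) by simp
  then have "\<not> ?N \<subseteq> set p"
    by (metis card_mono List.finite_set leD)
  then obtain x where x: "x \<in> ?N" "x \<notin> set p" by blast
  then have "x \<noteq> v" using simple_edge(1)[OF E] by (auto simp: nbrs_in_def)
  then have "is_path E (v # x # p)"
    using p x by (auto simp: is_path_def nbrs_in_def successively_Cons insert_commute)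
  then show "\<exists>p. is_path E p \<and> hd p = v \<and> last p = u \<and> set p \<subseteq> S \<and> L \<le> length p"
    using p x vu by (intro exI[of _ "v # x # p"]) (auto simp: nbrs_in_def is_path_def)
qed

section \<open>Balanced signed graphs\<close>

text \<open>
  Harary's theorem, by induction on the edges.  If a potential for the other edges is wrong on the new
  edge \<open>{u, v}\<close>, then a path between its ends would have the sign \<open>\<epsilon> u * \<epsilon> v\<close> and close a negative
  cycle with the edge.  So \<open>u\<close> and \<open>v\<close> lie in different components, and negating the potential on one of
  them repairs it.
\<close>
lemma potential_of_no_negative_cycle:
  assumes "finite E" "\<forall>e\<in>E. card e = 2" "\<forall>e\<in>E. \<sigma> e \<in> {1, - 1}" "\<not> (\<exists>xs. neg_cycle E \<sigma> xs)"
  shows "\<exists>\<epsilon> :: 'a \<Rightarrow> int. (\<forall>x. \<epsilon> x \<in> {1, - 1}) \<and> (\<forall>x y. {x, y} \<in> E \<longrightarrow> \<sigma> {x, y} = \<epsilon> x * \<epsilon> y)"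
  using assms
proof (induction E rule: finite_induct)
  case empty
  show ?case by (intro exI[of _ "\<lambda>_. 1"]) auto
next
  case (insert e E)
  have "\<not> (\<exists>xs. neg_cycle E \<sigma> xs)"
    using insert.prems(3) neg_cycle_mono[of E \<sigma> _ "insert e E"] by blast
  then obtain \<epsilon> :: "'a \<Rightarrow> int" where
    eps: "\<forall>x. \<epsilon> x \<in> {1, - 1}" "\<forall>x y. {x, y} \<in> E \<longrightarrow> \<sigma> {x, y} = \<epsilon> x * \<epsilon> y"
    using insert by auto
  obtain u v where e: "e = {u, v}" "u \<noteq> v"
    using insert.prems(1) by (auto simp: card_2_iff)
  have sq: "\<epsilon> x * \<epsilon> x = 1" for x
    using eps(1)[rule_format, of x] by auto
  have walk_eps: "walk_sign \<sigma> p = \<epsilon> (hd p) * \<epsilon> (last p)" if "walk E p" "p \<noteq> []" for p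
    using that
  proof (induction p rule: induct_list012)
    case (3 x y zs)
    then have "walk_sign \<sigma> (x # y # zs) = \<epsilon> x * (\<epsilon> y * \<epsilon> y) * \<epsilon> (last (y # zs))"
      using eps(2) by simp
    then show ?case by (simp add: sq)
  qed (auto simp: sq)
  \<comment> \<open>The vertices that \<open>u\<close> can reach without the new edge.\<close>
  define R where "R = {x. \<exists>p. is_path E p \<and> hd p = u \<and> last p = x}"
  have uR: "u \<in> R" unfolding R_def by (auto simp: is_path_def intro!: exI[of _ "[u]"])
  have R_closed: "y \<in> R" if xR: "x \<in> R" and xy: "{x, y} \<in> E" for x y
  proof -
    obtain p where p: "is_path E p" "hd p = u" "last p = x"
      using xR by (auto simp: R_def)
    show ?thesis
    proof (cases "y \<in> set p")
      case True
      then obtain A B where "p = A @ y # B" by (meson split_list)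
      then have "is_path E (A @ [y])" "hd (A @ [y]) = u"
        using p walk_append[of E A y B] by (auto simp: is_path_def hd_append)
      then show ?thesis unfolding R_def by (intro CollectI exI[of _ "A @ [y]"]) auto
    next
      case False
      then have "is_path E (p @ [y])" "hd (p @ [y]) = u"
        using p xy by (auto simp: is_path_def successively_append_iff)
      then show ?thesis unfolding R_def by (intro CollectI exI[of _ "p @ [y]"]) auto
    qed
  qed
  show ?case
  proof (cases "\<sigma> e = \<epsilon> u * \<epsilon> v")
    case True
    have "\<sigma> {x, y} = \<epsilon> x * \<epsilon> y" if "{x, y} \<in> insert e E" for x y
    proof (cases "{x, y} = e")
      case xy: True
      then have "x = u \<and> y = v \<or> x = v \<and> y = u"
        using e by (auto simp: doubleton_eq_iff)
      then show ?thesis using True xy by auto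
    next
      case False
      then show ?thesis using that eps(2) by blast
    qed
    then show ?thesis using eps(1) by blast
  next
    case False
    then have neg: "\<sigma> e = - (\<epsilon> u * \<epsilon> v)"
      using insert.prems(2) eps(1)[rule_format, of u] eps(1)[rule_format, of v] by auto
    have "v \<notin> R"
    proof
      assume "v \<in> R"
      then obtain p where p: "is_path E p" "hd p = u" "last p = v" by (auto simp: R_def)
      then obtain Q where Q: "p = u # Q @ [v]"
      proof (cases p)
        case (Cons x r)
        then have "r \<noteq> []" "x = u" "last r = v" using p e(2) by auto
        then have "p = u # butlast r @ [v]"
          using append_butlast_last_id[of r] Cons by simp
        then show ?thesis using that by blast
      qed (use p in \<open>simp add: is_path_def\<close>)
      have "Q \<noteq> []"
        using p Q insert.hyps e by (auto simp: is_path_def)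
      then have "3 \<le> length p" using Q by (cases Q) auto
      moreover have "walk (insert e E) (p @ [u])"
        using p e unfolding is_path_def successively_append_iff
        by (auto simp: insert_commute intro: successively_mono)
      moreover have "walk_sign \<sigma> (p @ [u]) = - 1"
      proof -
        have "walk_sign \<sigma> (p @ [u]) = walk_sign \<sigma> p * \<sigma> {v, u}"
          unfolding Q using walk_sign_append[of \<sigma> "u # Q" v "[u]"] by simp
        also have "\<dots> = (\<epsilon> u * \<epsilon> v) * - (\<epsilon> u * \<epsilon> v)"
          using walk_eps[of p] p neg e by (simp add: is_path_def insert_commute)
        also have "\<dots> = - ((\<epsilon> u * \<epsilon> u) * (\<epsilon> v * \<epsilon> v))" by (simp only: mult_ac mult_minus_right)
        finally show ?thesis by (simp add: sq)
      qed
      ultimately have "neg_cycle (insert e E) \<sigma> p"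
        using p by (simp add: neg_cycle_def is_path_def)
      then show False using insert.prems(3) by blast
    qed
    define \<epsilon>' where "\<epsilon>' x = (if x \<in> R then - \<epsilon> x else \<epsilon> x)" for x
    have "\<forall>x. \<epsilon>' x \<in> {1, - 1}" using eps(1) by (auto simp: \<epsilon>'_def)
    moreover have "\<sigma> {x, y} = \<epsilon>' x * \<epsilon>' y" if "{x, y} \<in> insert e E" for x y
    proof (cases "{x, y} = e")
      case True
      then have "x = u \<and> y = v \<or> x = v \<and> y = u"
        using e by (auto simp: doubleton_eq_iff)
      then show ?thesis
        using neg uR \<open>v \<notin> R\<close> True by (auto simp: \<epsilon>'_def)
    next
      case False
      then have "{x, y} \<in> E" using that by auto
      moreover from this have "x \<in> R \<longleftrightarrow> y \<in> R"
        using R_closed by (metis insert_commute)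
      ultimately show ?thesis using eps(2) by (auto simp: \<epsilon>'_def)
    qed
    ultimately show ?thesis by blast
  qed
qed

lemma sign_switching:
  "sign (switching U G) {x, y} = (if (x \<in> U) = (y \<in> U) then sign G {x, y} else - sign G {x, y})"
  by (auto simp: switching_def)

lemma exists_negative_cycle:
  assumes G: "signed_graph G" and "\<not> balanced G"
  shows "\<exists>xs. neg_cycle (edges G) (sign G) xs"
proof (rule ccontr)
  assume none: "\<not> ?thesis"
  have simple: "edges G \<subseteq> nsets (verts G) 2" "finite (verts G)"
    using G by (auto simp: signed_graph_def simple_graph_def)
  have "\<forall>e\<in>edges G. card e = 2" using simple by (auto simp: nsets_def)
  then obtain \<epsilon> :: "'a \<Rightarrow> int" where eps: "\<forall>x. \<epsilon> x \<in> {1, - 1}"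
    "\<forall>x y. {x, y} \<in> edges G \<longrightarrow> sign G {x, y} = \<epsilon> x * \<epsilon> y"
    using potential_of_no_negative_cycle[of "edges G" "sign G"] none finite_edges[OF simple] G
    by (auto simp: signed_graph_def)
  define U where "U = {v \<in> verts G. \<epsilon> v = - 1}"
  define H where "H = G\<lparr>sign := \<lambda>_. 1\<rparr>"
  have "sign H e = sign (switching U G) e" if e: "e \<in> edges G" for e
  proof -
    obtain x y where xy: "e = {x, y}" "x \<in> verts G" "y \<in> verts G"
      using simple_edgeE[OF simple(1) e] by metis
    then show ?thesis
      using eps(1)[rule_format, of x] eps(1)[rule_format, of y] eps(2)[rule_format, of x y] e
      by (auto simp: sign_switching H_def U_def)
  qed
  moreover have "U \<subseteq> verts G" by (auto simp: U_def)
  moreover have "signed_graph H" "all_positive H" "verts H = verts G" "edges H = edges G"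
    using G by (auto simp: H_def signed_graph_def all_positive_def simple_graph_def)
  ultimately have "balanced G"
    unfolding balanced_def switching_equivalent_def by metis
  then show False using assms by blast
qed

lemma triangle_not_balanced:
  assumes G: "{x, y} \<in> edges G" "{x, z} \<in> edges G" "{y, z} \<in> edges G"
    and neg: "sign G {x, y} * sign G {y, z} * sign G {x, z} = - 1"
  shows "\<not> balanced G"
proof
  assume "balanced G"
  then obtain U where U: "\<forall>e\<in>edges G. sign (switching U G) e = 1"
    unfolding balanced_def switching_equivalent_def all_positive_def by metis
  show False
    using U[rule_format, OF G(1)] U[rule_format, OF G(2)] U[rule_format, OF G(3)] neg
    unfolding sign_switching by (auto split: if_splits)
qed

section \<open>The structure of dense unbalanced graphs\<close>

text \<open>
  At least two thirds of the vertices lie outside a smallest part.  The factor \<open>2 / 3\<close> leaves room for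
  the degree ratio \<open>3 / 5\<close> of the dense core, which in turn exceeds the \<open>1 / 2\<close> needed for long paths.
\<close>
lemma turan_number_growth:
  assumes "3 \<le> r"
  shows "3 * turan_number r m + 2 * m \<le> 3 * turan_number r (Suc m)"
proof -
  have "m div r \<le> m div 3" using assms by (intro div_le_mono2) auto
  then have "3 * (m div r) \<le> m" by linarith
  then show ?thesis by simp
qed

text \<open>
  The summed form of the previous bound: \<open>3 * turan_number r m - m * (m - 1)\<close> is monotone in \<open>m\<close>.
\<close>
lemma turan_number_diff:
  assumes "3 \<le> r" "a \<le> b"
  shows "3 * turan_number r a + b * b + a \<le> 3 * turan_number r b + a * a + b"
  using assms(2)
proof (induction b rule: dec_induct)
  case (step b)
  then show ?case using turan_number_growth[OF assms(1), of b] by (simp del: turan_number.simps)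
qed simp

lemma turan_number_mono: "a \<le> b \<Longrightarrow> turan_number r a \<le> turan_number r b"
  by (rule lift_Suc_mono_le[of "turan_number r"]) (unfold turan_number.simps, rule le_add1)

text \<open>
  The core maximises \<open>10 e(K) - 3 |K|\<^sup>2\<close>.  Removing a vertex of \<open>K\<close> does not increase this value, which
  bounds its degree from below by about \<open>3 / 5\<close> of \<open>|K|\<close>.  On the other hand Turan's theorem bounds
  \<open>e(K)\<close>, and the extremal numbers grow at least like \<open>|K|\<^sup>2 / 3\<close>, which is more than \<open>3 |K|\<^sup>2 / 10\<close>.
  Thus leaving out many vertices loses more in \<open>e(K)\<close> than it gains in the quadratic term.
\<close>
lemma exists_dense_core:
  assumes r: "3 \<le> r" and V: "finite V" and E: "E \<subseteq> nsets V 2" "cliques_le r V E"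
    and many: "turan_number r (card V - 2) \<le> card E"
  shows "\<exists>K\<subseteq>V. card V \<le> card K + 50 \<and> (\<forall>x\<in>K. 6 * card K \<le> 10 * card (nbrs_in E K x) + 3)"
proof -
  define f :: "'a set \<Rightarrow> int" where
    "f S = 10 * int (card (induced E S)) - 3 * (int (card S))\<^sup>2" for S
  have "Max (f ` Pow V) \<in> f ` Pow V" using V by (intro Max_in) auto
  then obtain K where K: "K \<subseteq> V" "f K = Max (f ` Pow V)" by auto
  then have max: "f S \<le> f K" if "S \<subseteq> V" for S
    using V that by (simp add: Max_ge)
  have fin: "finite K" using K V finite_subset by blast
  have "6 * card K \<le> 10 * card (nbrs_in E K x) + 3" if x: "x \<in> K" for x
  proof -
    define S where "S = K - {x}"
    have S: "K = insert x S" "x \<notin> S" "finite S"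
      using x fin by (auto simp: S_def)
    have "nbrs_in E K x = nbrs_in E S x"
      using simple_edge(1)[OF E(1)] by (auto simp: nbrs_in_def S)
    moreover have "f S \<le> f K" using max K S by auto
    ultimately have "0 \<le> 10 * int (card (nbrs_in E K x)) - 3 * (int (Suc (card S)))\<^sup>2 + 3 * (int (card S))\<^sup>2"
      using card_induced_insert[OF E(1) S(3,2)] S by (simp add: f_def)
    then show ?thesis
      using S by (simp add: power2_eq_square algebra_simps)
  qed
  moreover have "card V \<le> card K + 50"
  proof (rule ccontr)
    define n k where "n = card V" and "k = card K"
    assume "\<not> ?thesis"
    then have far: "k + 51 \<le> n" by (simp add: n_def k_def)
    have "card (induced E K) \<le> turan_number r k"
      unfolding k_def using r fin induced_simple[OF E(1)]
      by (intro turan_bound) (auto intro: cliques_le_mono[OF E(2) K(1)] simp: induced_def nsets_def)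
    moreover have "f V \<le> f K" using max by simp
    moreover define m where "m = n - 2"
    then have m: "int n = int m + 2" "k \<le> m" using far by auto
    have "int (3 * turan_number r k + m * m + k) \<le> int (3 * turan_number r m + k * k + m)"
      unfolding of_nat_le_iff using m by (intro turan_number_diff[OF r]) simp
    moreover have "int (turan_number r m) \<le> int (card E)"
      using many by (simp add: m_def n_def)
    ultimately have "(int n)\<^sup>2 - (int k)\<^sup>2 \<le> 50 * int n"
      using induced_self[OF E(1)] m(1)
      by (simp add: f_def n_def[symmetric] k_def[symmetric] power2_eq_square algebra_simps)
    \<comment> \<open>If more than \<open>50\<close> vertices were left out, \<open>n\<^sup>2 - k\<^sup>2 = (n - k) * (n + k)\<close> would exceed \<open>50 * n\<close>.\<close>
    moreover have "51 * (int n + int k) \<le> (int n - int k) * (int n + int k)"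
      using far by (intro mult_right_mono) auto
    ultimately show False
      using far by (simp add: power2_eq_square algebra_simps)
  qed
  ultimately show ?thesis using K by blast
qed

text \<open>
  Any inclusion-maximal linked set above \<open>K\<close> will do, as a vertex with two neighbours in it could be
  added.
\<close>
lemma exists_linked_superset:
  assumes "finite V" "K \<subseteq> V" "linked E L K"
  shows "\<exists>B. K \<subseteq> B \<and> B \<subseteq> V \<and> linked E L B \<and> (\<forall>w\<in>V - B. card (nbrs_in E B w) \<le> 1)"
proof -
  have "finite {B. B \<subseteq> V \<and> linked E L B}" using assms by simp
  then obtain B where B: "B \<subseteq> V" "linked E L B" "K \<subseteq> B"
    and max: "\<And>B'. B' \<subseteq> V \<Longrightarrow> linked E L B' \<Longrightarrow> B \<subseteq> B' \<Longrightarrow> B = B'"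
    using finite_has_maximal2[of "{B. B \<subseteq> V \<and> linked E L B}" K] assms by auto
  have "card (nbrs_in E B w) \<le> 1" if w: "w \<in> V - B" for w
  proof (rule ccontr)
    assume "\<not> ?thesis"
    moreover have "finite (nbrs_in E B w)"
      using B assms finite_nbrs_in finite_subset by metis
    ultimately obtain a b where "a \<in> nbrs_in E B w" "b \<in> nbrs_in E B w" "a \<noteq> b"
      using card_le_Suc0_iff_eq[of "nbrs_in E B w"] by auto
    then have "linked E L (insert w B)"
      using linked_insert[OF B(2)] w by blast
    then show False using max[of "insert w B"] w B by auto
  qed
  then show ?thesis using B by blast
qed

lemma card_edges_pendant:
  assumes E: "E \<subseteq> nsets V 2" and "finite B" "finite D" "B \<inter> D = {}"
    and "\<forall>w\<in>D. card (nbrs_in E B w) \<le> 1"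
  shows "card (induced E (B \<union> D)) \<le> card (induced E B) + card D * card D"
  using assms(3-5)
proof (induction D rule: finite_induct)
  case (insert w D)
  have "nbrs_in E (B \<union> D) w \<subseteq> nbrs_in E B w \<union> D" by (auto simp: nbrs_in_def)
  then have "card (nbrs_in E (B \<union> D) w) \<le> card (nbrs_in E B w \<union> D)"
    using assms(2) insert.hyps by (intro card_mono) (auto simp: finite_nbrs_in)
  also have "\<dots> \<le> card (nbrs_in E B w) + card D" by (rule card_Un_le)
  finally have "card (nbrs_in E (B \<union> D) w) \<le> 1 + card D" using insert.prems by fastforce
  moreover have "card (induced E (insert w (B \<union> D))) = card (induced E (B \<union> D)) + card (nbrs_in E (B \<union> D) w)"
    using assms(2) insert by (intro card_induced_insert[OF E]) auto
  ultimately show ?case using insert by simp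
qed simp

lemma negative_triangle_edges:
  assumes Z: "neg_cycle E \<sigma> Z" and xyz: "set Z = {x, y, z}" "x \<noteq> y" "x \<noteq> z" "y \<noteq> z"
  shows "{x, y} \<in> E" "{x, z} \<in> E" "{y, z} \<in> E" "\<sigma> {x, y} * \<sigma> {y, z} * \<sigma> {x, z} = - 1"
proof -
  have "length Z = 3"
    using Z distinct_card[of Z] xyz by (simp add: neg_cycle_def)
  then obtain a b c where abc: "Z = [a, b, c]"
    by (auto simp: numeral_3_eq_3 length_Suc_conv)
  have E: "{a, b} \<in> E" "{b, c} \<in> E" "{c, a} \<in> E" and d: "a \<noteq> b" "b \<noteq> c" "a \<noteq> c"
    and s: "\<sigma> {a, b} * (\<sigma> {b, c} * \<sigma> {c, a}) = - 1"
    using Z by (auto simp: abc neg_cycle_def)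
  have "{a, b, c} \<subseteq> {x, y, z}" using xyz(1) by (simp add: abc)
  then have "(a = x \<or> a = y \<or> a = z) \<and> (b = x \<or> b = y \<or> b = z) \<and> (c = x \<or> c = y \<or> c = z)"
    by simp
  then consider "a = x" "b = y" "c = z" | "a = x" "b = z" "c = y" | "a = y" "b = x" "c = z"
    | "a = y" "b = z" "c = x" | "a = z" "b = x" "c = y" | "a = z" "b = y" "c = x"
    using d by metis
  then have "{x, y} \<in> E \<and> {x, z} \<in> E \<and> {y, z} \<in> E \<and> \<sigma> {x, y} * \<sigma> {y, z} * \<sigma> {x, z} = - 1"
    by cases (use E s in \<open>simp_all add: insert_commute mult_ac\<close>)
  then show "{x, y} \<in> E" "{x, z} \<in> E" "{y, z} \<in> E" "\<sigma> {x, y} * \<sigma> {y, z} * \<sigma> {x, z} = - 1"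
    by auto
qed

text \<open>
  Let \<open>B\<close> be a maximal linked set above the dense core and \<open>D\<close> its complement, which has at most \<open>50\<close>
  vertices.  Every vertex of \<open>D\<close> has at most one neighbour in \<open>B\<close>, so \<open>D\<close> contributes only boundedly many
  edges, whereas each vertex missing from \<open>B\<close> lowers the extremal number by at least about
  \<open>2 n / 3\<close>.  The number of edges thus forces \<open>|D| \<le> 2\<close>.  The negative cycle \<open>Z\<close> has at most one vertex
  in \<open>B\<close>, so it needs two vertices in \<open>D\<close>; it is a triangle with exactly one vertex \<open>z\<close> in \<open>B\<close>, and
  \<open>z\<close> is the only neighbour in \<open>B\<close> of the other two.
\<close>
lemma structure_of_dense_unbalanced:
  assumes r: "3 \<le> r" and V: "finite V" and E: "E \<subseteq> nsets V 2" "cliques_le r V E"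
    and signs: "\<forall>e\<in>E. \<sigma> e \<in> {1, - 1}"
    and short: "\<And>xs. neg_cycle E \<sigma> xs \<Longrightarrow> length xs < l"
    and Z: "neg_cycle E \<sigma> Z"
    and many: "turan_number r (card V - 2) + 3 \<le> card E"
    and large: "5 * (l * l) + 4000 \<le> card V"
  obtains B x y z where "V = insert x (insert y B)" "x \<noteq> y" "x \<notin> B" "y \<notin> B" "z \<in> B"
    "E = induced E B \<union> {{x, y}, {x, z}, {y, z}}"
    "card (induced E B) = turan_number r (card V - 2)"
    "\<sigma> {x, y} * \<sigma> {y, z} * \<sigma> {x, z} = - 1"
    "\<not> (\<exists>xs. neg_cycle (induced E B) \<sigma> xs)"
proof -
  obtain K where K: "K \<subseteq> V" "card V \<le> card K + 50"
    "\<forall>x\<in>K. 6 * card K \<le> 10 * card (nbrs_in E K x) + 3"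
    using exists_dense_core[OF r V E] many by auto
  have finK: "finite K" using K V finite_subset by blast
  have linkK: "linked E (l * l) K"
  proof (rule linked_of_min_degree[OF E(1) finK])
    fix x assume "x \<in> K"
    then have "6 * card K \<le> 10 * card (nbrs_in E K x) + 3" using K by blast
    then show "card K + l * l + 3 \<le> 2 * card (nbrs_in E K x)"
      using large K(2) by linarith
  qed
  obtain B where B: "K \<subseteq> B" "B \<subseteq> V" "linked E (l * l) B"
    "\<forall>w\<in>V - B. card (nbrs_in E B w) \<le> 1"
    using exists_linked_superset[OF V K(1) linkK] by auto
  have finB: "finite B" using B V finite_subset by blast
  define D where "D = V - B"
  have D: "V = B \<union> D" "B \<inter> D = {}" "finite D" "\<forall>w\<in>D. card (nbrs_in E B w) \<le> 1"
    using B V by (auto simp: D_def)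
  have cards: "card V = card B + card D"
    using D finB by (simp add: card_Un_disjoint)
  have meets: "card (set xs \<inter> B) \<le> 1" if "neg_cycle E \<sigma> xs" for xs
    using negative_cycle_meets_linked_set[OF signs short that B(3)] .
  have setZ: "set Z \<subseteq> V" "3 \<le> card (set Z)"
    using neg_cycle_vertices[OF E(1) Z] Z by (auto simp: neg_cycle_def distinct_card)
  have splitZ: "card (set Z) = card (set Z \<inter> B) + card (set Z \<inter> D)"
  proof -
    have "set Z = (set Z \<inter> B) \<union> (set Z \<inter> D)" using setZ D by auto
    moreover have "(set Z \<inter> B) \<inter> (set Z \<inter> D) = {}" using D by auto
    ultimately show ?thesis by (metis List.finite_set card_Un_disjoint finite_Int)
  qed
  have ZD: "card (set Z \<inter> D) \<le> card D" using D by (intro card_mono) auto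
  have indB: "card (induced E B) \<le> turan_number r (card B)"
    using r finB induced_simple[OF E(1)]
    by (intro turan_bound) (auto intro: cliques_le_mono[OF E(2) B(2)] simp: induced_def nsets_def)
  have D2: "card D = 2"
  proof -
    have "2 \<le> card D" using splitZ ZD meets[OF Z] setZ(2) by linarith
    \<comment> \<open>A third missing vertex costs about \<open>2 n / 3\<close> edges, and \<open>D\<close> brings back at most \<open>50 * 50\<close>.\<close>
    moreover have "\<not> 3 \<le> card D"
    proof
      assume D3: "3 \<le> card D"
      have "card K \<le> card B" using B finB card_mono by blast
      then have "card D \<le> 50" using cards K(2) by linarith
      then have "card D * card D \<le> 50 * 50" by (intro mult_le_mono) auto
      then have "card E \<le> turan_number r (card B) + 2500"
        using card_edges_pendant[OF E(1) finB D(3,2,4)] indB induced_self[OF E(1)] D(1) by simp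
      also have "\<dots> \<le> turan_number r (card V - 3) + 2500"
        using cards D3 by (simp add: turan_number_mono)
      finally have "turan_number r (card V - 2) + 3 \<le> turan_number r (card V - 3) + 2500"
        using many by linarith
      moreover have "3 * turan_number r (card V - 3) + 2 * (card V - 3) \<le> 3 * turan_number r (card V - 2)"
        using turan_number_growth[OF r, of "card V - 3"] large
        by (simp add: numeral_3_eq_3 numeral_2_eq_2 Suc_diff_Suc del: turan_number.simps)
      ultimately show False using large by linarith
    qed
    ultimately show ?thesis by linarith
  qed
  then obtain x y where xy: "D = {x, y}" "x \<noteq> y" by (meson card_2_iff)
  have ZD2: "card (set Z \<inter> D) = 2" "card (set Z \<inter> B) = 1"
    using splitZ ZD D2 meets[OF Z] setZ(2) by linarith+
  then obtain z where z: "set Z \<inter> B = {z}" by (meson card_1_singletonE)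
  have "set Z \<inter> D = D" using ZD2 D2 D by (intro card_subset_eq) auto
  then have Zxyz: "set Z = {x, y, z}" using setZ D z xy by blast
  have zB: "z \<in> B" using z by blast
  have out: "x \<notin> B" "y \<notin> B" "x \<noteq> z" "y \<noteq> z" using xy D zB by auto
  note tri = negative_triangle_edges[OF Z Zxyz xy(2) out(3,4)]
  have single: "nbrs_in E B w = {z}" if "w \<in> D" "{w, z} \<in> E" for w
  proof -
    have "z \<in> nbrs_in E B w" using that zB by (simp add: nbrs_in_def)
    moreover have "finite (nbrs_in E B w)" using finB finite_nbrs_in by metis
    moreover have "card (nbrs_in E B w) \<le> 1" using D that by blast
    ultimately show ?thesis using card_le_Suc0_iff_eq[of "nbrs_in E B w"] by auto
  qed
  have Ny: "nbrs_in E B y = {z}" using single tri xy by simp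
  have "nbrs_in E B x = {z}" using single tri xy by simp
  then have Nx: "nbrs_in E (insert y B) x = {y, z}"
    using tri by (auto simp: nbrs_in_def)
  have Vxy: "V = insert x (insert y B)" using D xy by auto
  have E_eq: "E = induced E B \<union> {{x, y}, {x, z}, {y, z}}"
    using induced_self[OF E(1)] Vxy Nx Ny
    by (simp add: induced_insert[OF E(1)] Un_insert_left Un_insert_right insert_commute)
  have "card (induced E V) = card (induced E B) + 3"
    using Nx Ny out xy finB unfolding Vxy by (simp add: card_induced_insert[OF E(1)])
  then have "card E = card (induced E B) + 3"
    by (simp add: induced_self[OF E(1)])
  then have "card (induced E B) = turan_number r (card V - 2)"
    using many indB cards D2 by simp
  moreover have "\<not> (\<exists>xs. neg_cycle (induced E B) \<sigma> xs)"
  proof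
    assume "\<exists>xs. neg_cycle (induced E B) \<sigma> xs"
    then obtain xs where xs: "neg_cycle (induced E B) \<sigma> xs" by blast
    have "set xs \<subseteq> B" using neg_cycle_vertices[OF induced_simple[OF E(1)] xs] .
    then have "set xs \<inter> B = set xs" by blast
    moreover have "neg_cycle E \<sigma> xs" using neg_cycle_mono[OF xs] by (simp add: induced_def)
    ultimately have "card (set xs) \<le> 1" using meets by metis
    then show False using xs by (simp add: neg_cycle_def distinct_card)
  qed
  ultimately show thesis
    using that[of x y B z] Vxy xy out zB E_eq tri(4) by blast
qed

section \<open>A negative triangle glued to a Turan graph\<close>

text \<open>
  A cycle through \<open>x\<close> uses both \<open>y\<close> and \<open>z\<close> as its neighbours; then the other
  neighbour of \<open>y\<close> on it is \<open>z\<close> again, which closes a triangle.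
\<close>
lemma long_cycle_avoids_degree_two_twins:
  assumes Z: "neg_cycle E \<sigma> Z" "4 \<le> length Z"
    and x: "\<And>w. {x, w} \<in> E \<Longrightarrow> w \<in> {y, z}" and y: "\<And>w. {y, w} \<in> E \<Longrightarrow> w \<in> {x, z}"
  shows "x \<notin> set Z"
proof
  assume "x \<in> set Z"
  then obtain A D where "Z = A @ x # D" by (meson split_list)
  then have rot: "neg_cycle E \<sigma> (x # D @ A)" "length (D @ A) = length Z - 1"
    using neg_cycle_rotate[of E \<sigma> A "x # D"] Z by auto
  define L where "L = D @ A"
  have L3: "3 \<le> length L" using rot(2) Z(2) by (simp add: L_def)
  have cyc: "neg_cycle E \<sigma> (x # L)" using rot(1) by (simp add: L_def)
  obtain a L' where L': "L = a # L'" using L3 by (cases L) auto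
  then have "L' \<noteq> []" using L3 by auto
  then obtain M c where L: "L = a # M @ [c]" using L' by (metis append_butlast_last_id)
  have M: "M \<noteq> []" using L3 L by auto
  have dist: "distinct (x # a # M @ [c])" and walk: "walk E (x # a # M @ [c, x])"
    using cyc by (auto simp: neg_cycle_def L)
  have "{x, a} \<in> E" "{x, c} \<in> E"
    using walk by (auto simp: successively_append_iff successively_Cons insert_commute)
  then have ac: "a = y \<and> c = z \<or> a = z \<and> c = y" using x[of a] x[of c] dist by auto
  have "{a, hd M} \<in> E" "{c, last M} \<in> E"
    using walk M by (auto simp: successively_append_iff successively_Cons insert_commute)
  then have "hd M \<in> {x, z} \<or> last M \<in> {x, z}" using ac y by auto
  moreover have "hd M \<in> set M" "last M \<in> set M" using M by auto
  ultimately show False using dist ac by auto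
qed

lemma clique_number_le_iff:
  assumes "finite (verts G)"
  shows "clique_number G \<le> r \<longleftrightarrow> cliques_le r (verts G) (edges G)"
proof -
  have "{} \<in> {K. K \<subseteq> verts G \<and> clique K (edges G)}" by simp
  then have "card ` {K. K \<subseteq> verts G \<and> clique K (edges G)} \<noteq> {}" by blast
  then show ?thesis
    using assms by (auto simp: clique_number_def cliques_le_def)
qed

text \<open>
  A Turan graph with all edges positive and a triangle with one negative edge, sharing the vertex \<open>z\<close>.
  The negative edge \<open>{x, y}\<close> lies in no cycle other than that triangle, and the triangle respects the
  clique number because \<open>r\<close> is at least \<open>3\<close>.
\<close>
lemma exists_admissible:
  fixes V :: "'a set"
  assumes r: "3 \<le> r" and l: "4 \<le> l" and V: "finite V" "3 \<le> card V"
  shows "\<exists>H :: 'a signed_graph. admissible r l (card V) H \<and>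
           card (edges H) = turan_number r (card V - 2) + 3"
proof -
  obtain P where P: "P \<subseteq> V" "card P = 3"
    using obtain_subset_with_card_n[OF V(2)] by blast
  then obtain x y z where xyz: "P = {x, y, z}" "x \<noteq> y" "x \<noteq> z" "y \<noteq> z"
    by (metis card_3_iff)
  define S where "S = V - {x, y}"
  have S: "V = insert x (insert y S)" "x \<notin> S" "y \<notin> S" "z \<in> S" "finite S"
    using P xyz V by (auto simp: S_def)
  have card_S: "card S = card V - 2" using S xyz by simp
  obtain part where part: "balanced_partition r S part"
    "card (multipartite_edges S part) = turan_number r (card S)"
    using exists_turan_graph[OF S(5), of r] r by auto
  define T where "T = multipartite_edges S part"
  define E where "E = T \<union> {{x, y}, {x, z}, {y, z}}"
  define H :: "'a signed_graph" where
    "H = \<lparr>verts = V, edges = E, sign = \<lambda>e. if e = {x, y} then - 1 else 1\<rparr>"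
  have T: "T \<subseteq> nsets S 2" by (simp add: T_def multipartite_edges_simple)
  have E: "E \<subseteq> nsets V 2"
    using T xyz S nsets_mono[of S V 2] by (auto simp: E_def)
  have x: "w \<in> {y, z}" if "{x, w} \<in> E" for w
    using that S T simple_edge[OF T, of x w] xyz by (auto simp: E_def doubleton_eq_iff)
  have y: "w \<in> {x, z}" if "{y, w} \<in> E" for w
    using that S T simple_edge[OF T, of y w] xyz by (auto simp: E_def doubleton_eq_iff)
  have signed: "signed_graph H"
    using E V by (auto simp: signed_graph_def simple_graph_def H_def)
  have "cliques_le r V E"
    unfolding cliques_le_def
  proof (intro allI impI)
    fix K assume K: "K \<subseteq> V" "clique K E"
    show "card K \<le> r"
    proof (cases "x \<in> K \<or> y \<in> K")
      case True
      have "w \<in> {x, y, z}" if w: "w \<in> K" for w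
      proof -
        have "w = v \<or> {v, w} \<in> E" if "v \<in> K" for v
          using K(2) w that by (auto simp: clique_def)
        then show ?thesis using True x[of w] y[of w] by auto
      qed
      then have "K \<subseteq> {x, y, z}" by blast
      then have "card K \<le> card {x, y, z}" by (intro card_mono) auto
      then show ?thesis using r xyz by simp
    next
      case False
      then have "K \<subseteq> S" using K S by auto
      moreover have "clique K T"
        using K(2) False unfolding clique_def E_def by (auto simp: doubleton_eq_iff)
      moreover have "cliques_le r S T"
        unfolding T_def using part by (intro multipartite_cliques_le) (simp add: balanced_partition_def)
      ultimately show ?thesis by (simp add: cliques_le_def)
    qed
  qed
  then have "clique_number H \<le> r"
    using clique_number_le_iff[of H r] V by (simp add: H_def)
  moreover have "\<not> balanced H"
    by (rule triangle_not_balanced[of x y _ z]) (use xyz in \<open>auto simp: H_def E_def doubleton_eq_iff\<close>)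
  moreover have "long_negative_cycle_free l H"
    unfolding long_negative_cycle_free_def
  proof
    assume "\<exists>xs. negative_cycle H xs \<and> l \<le> length xs"
    then obtain xs where xs: "neg_cycle E (sign H) xs" "4 \<le> length xs"
      using negative_cycle_iff[of H] signed l by (auto simp: signed_graph_def H_def)
    have avoid: "x \<notin> set xs" "y \<notin> set xs"
      using long_cycle_avoids_degree_two_twins[OF xs, of x y z]
        long_cycle_avoids_degree_two_twins[OF xs, of y x z] x y by blast+
    have "walk_sign (sign H) p = 1" if "x \<notin> set p" for p
      using that
    proof (induction p rule: induct_list012)
      case (3 a b p)
      then show ?case by (auto simp: H_def doubleton_eq_iff)
    qed auto
    moreover have "x \<notin> set (xs @ [hd xs])" using avoid xs by (cases xs) auto
    ultimately have "walk_sign (sign H) (xs @ [hd xs]) = 1" by blast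
    then show False using xs(1) by (simp add: neg_cycle_def)
  qed
  ultimately have "admissible r l (card V) H"
    using signed by (simp add: admissible_def H_def)
  moreover have "card E = turan_number r (card V - 2) + 3"
  proof -
    have "{{x, y}, {x, z}, {y, z}} \<inter> T = {}"
      using simple_edge[OF T] S by blast
    moreover have "card {{x, y}, {x, z}, {y, z}} = 3"
      using xyz by (simp add: doubleton_eq_iff)
    moreover have "finite T" using finite_edges[OF T S(5)] .
    ultimately show ?thesis
      using part card_S unfolding E_def T_def[symmetric] by (subst card_Un_disjoint) auto
  qed
  ultimately show ?thesis by (intro exI[of _ H]) (simp add: H_def)
qed

section \<open>Extremal graphs\<close>

theorem corollary3:
  fixes r l :: nat
  assumes "r \<ge> 3" and "l \<ge> 4"
  shows "\<exists>n0. \<forall>n \<ge> n0. \<forall>G :: 'a signed_graph.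
           extremal r l n G \<longrightarrow>
           (\<exists>H :: 'a signed_graph.
              negative_triangle_dot_turan r (n - 2) H \<and> switching_isomorphic G H)"
\<comment> \<open>\<open>4000\<close> beats the at most \<open>50 * 50\<close> edges at the vertices outside the linked set; \<open>5 * (l * l)\<close> pays for the length of the linking paths.\<close>
proof (intro exI[of _ "5 * (l * l) + 4000"] allI impI)
  fix n and G :: "'a signed_graph"
  assume large: "5 * (l * l) + 4000 \<le> n" and ext: "extremal r l n G"
  have G: "signed_graph G" "card (verts G) = n" "long_negative_cycle_free l G"
    "\<not> balanced G" "clique_number G \<le> r"
    using ext by (auto simp: extremal_def admissible_def)
  have simple: "simple_graph G" "edges G \<subseteq> nsets (verts G) 2" "finite (verts G)"
    and signs: "\<forall>e\<in>edges G. sign G e \<in> {1, - 1}"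
    using G by (auto simp: signed_graph_def simple_graph_def)
  have cliques: "cliques_le r (verts G) (edges G)"
    using G clique_number_le_iff[OF simple(3)] by blast
  obtain F :: "'a signed_graph" where "admissible r l n F" "card (edges F) = turan_number r (n - 2) + 3"
    using exists_admissible[OF assms simple(3)] G(2) large by auto
  then have many: "turan_number r (card (verts G) - 2) + 3 \<le> card (edges G)"
    using ext G(2) unfolding extremal_def by metis
  have short: "length xs < l" if "neg_cycle (edges G) (sign G) xs" for xs
    using that G(3) negative_cycle_iff[OF simple(1)] unfolding long_negative_cycle_free_def
    by (meson not_le)
  obtain Z where Z: "neg_cycle (edges G) (sign G) Z"
    using exists_negative_cycle[OF G(1,4)] by blast
  have large': "5 * (l * l) + 4000 \<le> card (verts G)" using large G(2) by simp
  obtain B x y z where V: "verts G = insert x (insert y B)" "x \<noteq> y" "x \<notin> B" "y \<notin> B" "z \<in> B"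
    and E: "edges G = induced (edges G) B \<union> {{x, y}, {x, z}, {y, z}}"
    and card_T: "card (induced (edges G) B) = turan_number r (card (verts G) - 2)"
    and tri: "sign G {x, y} * sign G {y, z} * sign G {x, z} = - 1"
    and none: "\<not> (\<exists>xs. neg_cycle (induced (edges G) B) (sign G) xs)"
    using structure_of_dense_unbalanced[OF assms(1) simple(3,2) cliques signs short Z many large']
    by metis
  define T where "T = induced (edges G) B"
  have edges_G: "edges G = T \<union> {{x, y}, {x, z}, {y, z}}"
    unfolding T_def by (rule E)
  have finB: "finite B" and card_B: "card B = n - 2"
    using simple(3) V G(2) by auto
  have T: "T \<subseteq> nsets B 2" using induced_simple[OF simple(2)] by (simp add: T_def)
  have "cliques_le r B T"
    using V(1) by (intro cliques_le_mono[OF cliques]) (auto simp: T_def induced_def)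
  then have turan: "turan_graph r (n - 2) \<lparr>verts = B, edges = T\<rparr>"
    using turan_unique[of r B T] assms(1) finB T card_T card_B G(2)
    by (auto simp: turan_graph_iff T_def)
  have "\<forall>e\<in>T. card e = 2" using T by (auto simp: nsets_def)
  moreover have "\<forall>e\<in>T. sign G e \<in> {1, - 1}" using signs by (auto simp: T_def induced_def)
  ultimately obtain \<epsilon> :: "'a \<Rightarrow> int" where eps: "\<forall>v. \<epsilon> v \<in> {1, - 1}"
    "\<forall>u v. {u, v} \<in> T \<longrightarrow> sign G {u, v} = \<epsilon> u * \<epsilon> v"
    using potential_of_no_negative_cycle[of T "sign G"] none finite_edges[OF T finB]
    by (auto simp: T_def)
  \<comment> \<open>Switching at \<open>U\<close> makes all edges inside \<open>B\<close> positive and keeps the triangle negative.\<close>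
  define U where "U = {v \<in> B. \<epsilon> v = - 1}"
  define C :: "'a signed_graph" where "C = \<lparr>verts = {x, y, z}, edges = {{x, y}, {x, z}, {y, z}},
    sign = sign (switching U G)\<rparr>"
  define H where "H = signed_union C (positive_signed \<lparr>verts = B, edges = T\<rparr>)"
  have neq: "x \<noteq> z" "y \<noteq> z" using V by auto
  have notU: "x \<notin> U" "y \<notin> U" using V by (auto simp: U_def)
  have tri_sign: "sign (switching U G) {x, y} * sign (switching U G) {y, z} * sign (switching U G) {x, z} = - 1"
    using tri notU by (simp add: sign_switching)
  have "negative_triangle C"
    unfolding negative_triangle_def
  proof
    have unit: "sign (switching U G) e \<in> {1, - 1}" if "e \<in> edges G" for e
      using signs that by (auto simp: switching_def)
    show "signed_graph C"
      using unit edges_G V(2) neq by (auto simp: signed_graph_def simple_graph_def C_def)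
    have "cycle_edges [x, y, z] = edges C"
      by (auto simp: cycle_edges_conv_image C_def lessThan_Suc numeral_2_eq_2 insert_commute)
    moreover have "neg_cycle (edges C) (sign C) [x, y, z]"
      using tri_sign V(2) neq by (auto simp: neg_cycle_def C_def insert_commute)
    then have "negative_cycle C [x, y, z]"
      using \<open>signed_graph C\<close> negative_cycle_iff by (auto simp: signed_graph_def)
    ultimately show "\<exists>xs. length xs = 3 \<and> verts C = set xs \<and> edges C = cycle_edges xs \<and> negative_cycle C xs"
      by (intro exI[of _ "[x, y, z]"]) (auto simp: C_def)
  qed
  moreover have "verts C \<inter> verts \<lparr>verts = B, edges = T\<rparr> = {z}"
    using V by (auto simp: C_def)
  ultimately have "negative_triangle_dot_turan r (n - 2) H"
    unfolding negative_triangle_dot_turan_def using turan H_def by blast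
  \<comment> \<open>Switching twice at \<open>U\<close> changes nothing, so \<open>G\<close> itself is the switching of \<open>H\<close> that is isomorphic to \<open>G\<close>.\<close>
  moreover have "switching_equivalent H G"
    unfolding switching_equivalent_def
  proof (intro conjI exI[of _ U] ballI)
    show verts: "verts G = verts H" and edges: "edges G = edges H"
      using V by (auto simp: H_def signed_union_def positive_signed_def C_def edges_G)
    show "U \<subseteq> verts H" using verts V by (auto simp: U_def)
    fix e assume "e \<in> edges H"
    then have e: "e \<in> edges G" using edges by simp
    then obtain u v where uv: "e = {u, v}" "u \<in> verts G" "v \<in> verts G"
      using simple_edgeE[OF simple(2)] by metis
    have "sign H {u, v} = sign (switching U G) {u, v}"
    proof (cases "e \<in> edges C")
      case True
      then show ?thesis using uv by (simp add: H_def signed_union_def C_def)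
    next
      case False
      then have eT: "{u, v} \<in> T" using e uv by (auto simp: C_def edges_G)
      then have "u \<in> B" "v \<in> B" using simple_edge[OF T] by auto
      then have "sign (switching U G) {u, v} = 1"
        using eps(1)[rule_format, of u] eps(1)[rule_format, of v] eps(2)[rule_format, OF eT]
        by (auto simp: sign_switching U_def)
      then show ?thesis using False uv by (simp add: H_def signed_union_def positive_signed_def)
    qed
    then show "sign G e = sign (switching U H) e"
      unfolding uv(1) by (simp add: sign_switching)
  qed
  moreover have "isomorphic G G"
    unfolding isomorphic_def by (intro exI[of _ id]) auto
  ultimately show "\<exists>H :: 'a signed_graph. negative_triangle_dot_turan r (n - 2) H \<and> switching_isomorphic G H"
    unfolding switching_isomorphic_def by blast
qed

end
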